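(* Let $q$ be an odd prime power, $d\ge 2$, $t\in\mathbb{F}_q^*$, and let $E\subseteq\mathbb{F}_q^d$ with $|E|\ge Cq^{\frac{d+1}{2}}$, where $C>4$. Then for any $\lambda>\frac{2C}{C-4}$ there exists a subset $E^*\subseteq E$ with \[ |E^*|\ge \frac{1-2\lambda^{-1}}{2\lambda}|E| \] such that for every $x\in E^*$, \[ \lambda^{-1}\frac{|E|}{q}\le E*S(x)\le \lambda\frac{|E|}{q}. \]
   Context: For $x\in\mathbb{F}_q^d$, $\lVert x\rVert=x_1^2+\dots+x_d^2$. $S(x)=1$ if $\lVert x\rVert=t$ and $S(x)=0$ otherwise; identifying $E$ with its indicator function, $E*S(x)=\sum_{y\in\mathbb{F}_q^d}E(y)S(x-y)=\#\{y\in E:\lVert x-y\rVert=t\}$. *)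

theory Defs
  imports "HOL-Analysis.Finite_Cartesian_Product" "HOL-Library.Indicator_Function"
begin

text \<open>
  The field with $q$ elements is a type \<open>'a :: {field, finite}\<close> with \<open>CARD('a) = q\<close>, and its
  $d$-dimensional coordinate space is \<open>'a ^ 'd\<close> with \<open>CARD('d) = d\<close>. The cardinality of a finite
  field is automatically a prime power.
\<close>

definition qnorm :: "('a::field) ^ ('d::finite) \<Rightarrow> 'a" where
  "qnorm x = (\<Sum>i\<in>UNIV. (x $ i)\<^sup>2)"

definition sphere_ind :: "'a::field \<Rightarrow> 'a ^ ('d::finite) \<Rightarrow> real" where
  "sphere_ind t x = (if qnorm x = t then 1 else 0)"

definition conv :: "('v::{finite,minus} \<Rightarrow> real) \<Rightarrow> ('v \<Rightarrow> real) \<Rightarrow> 'v \<Rightarrow> real" where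
  "conv f g x = (\<Sum>y\<in>UNIV. f y * g (x - y))"

lemma conv_indicator_sphere_ind:
  fixes E :: "(('a::{field,finite}) ^ ('d::finite)) set"
  shows "conv (indicator E) (sphere_ind t) x = real (card {y \<in> E. qnorm (x - y) = t})"
proof -
  have "conv (indicator E) (sphere_ind t) x = (\<Sum>y\<in>UNIV. if y \<in> {y \<in> E. qnorm (x - y) = t} then 1 else 0)"
    unfolding conv_def sphere_ind_def by (intro sum.cong) (auto simp: indicator_def)
  also have "\<dots> = real (card {y \<in> E. qnorm (x - y) = t})"
    by (subst sum.If_cases) simp_all
  finally show ?thesis .
qed

end

theory Submission
  imports Defs "HOL-Algebra.Algebraic_Closure_Type"
begin

text \<open>
  Let \<open>f = E * S\<close> and \<open>h = S - 1/q\<close>, so that \<open>f - |E|/q = E * h\<close>. The Fourier transform of \<open>h\<close> is a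
  combination of Gauss sums with a Kloosterman sum (\<open>d\<close> even) or a Salie sum (\<open>d\<close> odd), and is bounded by
  \<open>2 q^((d-1)/2)\<close> at every frequency, zero included. By Plancherel the sum of \<open>(f x - |E|/q)^2\<close> over all
  \<open>x\<close> is at most \<open>4 q^(d-1) |E|\<close>, and Chebyshev's inequality shows that fewer than a quarter of the points
  of \<open>E\<close> violate \<open>|f x - |E|/q| \<le> (1 - 1/\<lambda>) |E|/q\<close>, which is stronger than the required two-sided bound.

  The bound \<open>2 \<surd>q\<close> for Kloosterman sums is Weil's. The L-function attached to the sum, a sum over monic
  polynomials over the field, is \<open>1 + K T + q T^2\<close>, hence the sums over the extension of degree \<open>n\<close> are
  \<open>- (\<alpha>^n + \<beta>^n)\<close> with \<open>\<alpha> + \<beta> = - K\<close> and \<open>\<alpha> \<beta> = q\<close>. For even \<open>n = 2m\<close>, Stepanov's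
  method bounds the number of \<open>x\<close> with \<open>Tr (x + a/x) = u\<close> by \<open>q^(n-1) + 3 q^m\<close>, which bounds the total
  of these power sums over all nontrivial characters by \<open>O(q^m)\<close>. As Kloosterman sums are real, a single
  \<open>|K| > 2 \<surd>q\<close> would make the total grow faster.
\<close>

section \<open>Frobenius on the algebraic closure of a finite field\<close>

text \<open>All extensions of the base field live in one type: the field with \<open>q^n\<close>
  elements is the fixed set of the \<open>n\<close>-th Frobenius power in
  \<open>alg_closure\<close>. The Euler product over irreducibles is replaced by counting, for a
  given \<open>f\<close>, the pairs of \<open>k\<close> and a point \<open>x\<close> of the
  degree-\<open>k\<close> extension whose norm polynomial divides \<open>f\<close>; there are
  \<open>degree f\<close> of them.

  Stepanov's method only bounds each trace fibre from above. The fibres partition the nonzero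
  points, so bounding \<open>q - 1\<close> of them from above bounds the last one from below, and
  orthogonality turns that fibre into a sum over all nontrivial characters. A single Kloosterman sum
  is not reached this way; realness enters because it prevents the other sums from cancelling a
  large one.

  Origin of the threshold: \<open>lam > 2C/(C-4)\<close> says that
  \<open>1 - 1/lam > (C+4)/(2C)\<close>. As \<open>|E|/q\<close> is at least
  \<open>C q^((d-1)/2)\<close>, the allowed deviation is at least
  \<open>(C+4)/2 q^((d-1)/2)\<close>, which exceeds \<open>4 q^((d-1)/2)\<close>, twice the bound on
  the transform of \<open>h\<close>; squaring this 2 gives the quarter.\<close>

lemma field_power_card:
  fixes x :: "'a::{field,finite}"
  shows "x ^ CARD('a) = x"
proof (cases "x = 0")
  case False
  have "x * (\<Prod>y\<in>UNIV-{0}. x * y) = x * x ^ (CARD('a) - 1) * \<Prod>(UNIV-{0})"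
    by (simp add: prod.distrib mult_ac)
  also have "x * x ^ (CARD('a) - 1) = x ^ CARD('a)"
    by (metis One_nat_def Suc_diff_Suc diff_zero finite_UNIV_card_ge_0 finite power_Suc)
  also have "(\<Prod>y\<in>UNIV-{0}. x * y) = (\<Prod>y\<in>UNIV-{0}. y)"
    by (rule prod.reindex_bij_witness[of _ "\<lambda>y. y / x" "\<lambda>y. x * y"]) (use False in auto)
  finally show ?thesis
    by simp
qed simp

lemma card_field_gt_1: "CARD('a::{field,finite}) > 1"
proof -
  have "card {0, 1 :: 'a} \<le> CARD('a)"
    by (intro card_mono) auto
  thus ?thesis by simp
qed

text \<open>The polynomial \<open>(X + 1)^q - X^q - 1\<close> has degree below \<open>q\<close> and vanishes on all of the field.\<close>
lemma of_nat_binomial_card_eq_0: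
  assumes "0 < i" "i < CARD('a::{field,finite})"
  shows "of_nat (CARD('a) choose i) = (0::'a)"
proof -
  let ?q = "CARD('a)"
  define P :: "'a poly" where "P = (\<Sum>i\<in>{0<..<?q}. Polynomial.monom (of_nat (?q choose i)) i)"
  have "poly P x = 0" for x
  proof -
    have "(x + 1) ^ ?q = (\<Sum>i\<le>?q. of_nat (?q choose i) * x ^ i)"
      by (subst binomial_ring) simp
    also have "{..?q} = insert 0 (insert ?q {0<..<?q})"
      by auto
    also have "(\<Sum>i\<in>\<dots>. of_nat (?q choose i) * x ^ i) = 1 + x ^ ?q + poly P x"
      by (subst sum.insert) (auto simp: P_def poly_sum poly_monom add_ac)
    finally show ?thesis
      by (simp add: field_power_card)
  qed
  hence all: "{x. poly P x = 0} = UNIV" by auto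
  have "degree P \<le> ?q - 1"
    unfolding P_def by (intro degree_sum_le) (auto intro: order.trans[OF degree_monom_le])
  hence "P = 0"
    using card_poly_roots_bound[of P] all card_field_gt_1[where ?'a='a] by force
  have "Polynomial.coeff P i = of_nat (?q choose i)"
    using assms by (simp add: P_def coeff_sum)
  thus ?thesis using \<open>P = 0\<close> by simp
qed

lemma of_nat_card_eq_0: "of_nat CARD('a::{field,finite}) = (0::'a)"
  using of_nat_binomial_card_eq_0[of 1, where ?'a='a] card_field_gt_1[where ?'a='a] by simp

lemma frob_add:
  fixes x y :: "'a::{field,finite} alg_closure"
  shows "(x + y) ^ (CARD('a) ^ k) = x ^ (CARD('a) ^ k) + y ^ (CARD('a) ^ k)"
proof -
  let ?q = "CARD('a)"
  have *: "(x + y) ^ ?q = x ^ ?q + y ^ ?q" for x y :: "'a alg_closure"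
  proof -
    have "of_nat (?q choose i) = (0 :: 'a alg_closure)" if "0 < i" "i < ?q" for i
      by (metis of_nat_binomial_card_eq_0 that to_ac_0 to_ac_of_nat)
    hence "(\<Sum>i\<in>{0<..<?q}. of_nat (?q choose i) * x ^ i * y ^ (?q - i)) = 0"
      by (intro sum.neutral) auto
    moreover have "(x + y) ^ ?q = (\<Sum>i\<le>?q. of_nat (?q choose i) * x ^ i * y ^ (?q - i))"
      by (rule binomial_ring)
    moreover have "{..?q} = insert 0 (insert ?q {0<..<?q})"
      by auto
    ultimately show ?thesis
      by (simp add: add_ac)
  qed
  show ?thesis
    by (induction k arbitrary: x y) (simp_all add: power_mult *)
qed

lemma frob_minus:
  fixes x :: "'a::{field,finite} alg_closure"
  shows "(-x) ^ (CARD('a) ^ k) = - (x ^ (CARD('a) ^ k))"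
  using frob_add[of x "-x" k] by (simp add: add_eq_0_iff power_0_left)

lemma frob_diff:
  fixes x y :: "'a::{field,finite} alg_closure"
  shows "(x - y) ^ (CARD('a) ^ k) = x ^ (CARD('a) ^ k) - y ^ (CARD('a) ^ k)"
  using frob_add[of x "-y" k] by (simp add: frob_minus)

lemma frob_sum:
  fixes f :: "'b \<Rightarrow> 'a::{field,finite} alg_closure"
  shows "(\<Sum>i\<in>A. f i) ^ (CARD('a) ^ k) = (\<Sum>i\<in>A. f i ^ (CARD('a) ^ k))"
  by (induction A rule: infinite_finite_induct) (simp_all add: frob_add power_0_left)

lemma frob_inject:
  fixes x y :: "'a::{field,finite} alg_closure"
  assumes "x ^ (CARD('a) ^ k) = y ^ (CARD('a) ^ k)"
  shows "x = y"
proof -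
  have "(x - y) ^ (CARD('a) ^ k) = 0"
    using assms by (simp add: frob_diff)
  thus ?thesis by simp
qed

lemma frob_compose:
  fixes x :: "'a::monoid_mult"
  shows "(x ^ (q ^ i)) ^ (q ^ j) = x ^ (q ^ (i + j))"
  by (simp add: power_mult power_add)

lemma to_ac_frob [simp]: "to_ac (x::'a::{field,finite}) ^ CARD('a) = to_ac x"
  by (metis field_power_card to_ac_power)

lemma to_ac_frob_power [simp]: "to_ac (x::'a::{field,finite}) ^ (CARD('a) ^ k) = to_ac x"
  by (induction k) (simp_all add: power_mult)

lemma card_frob_fixed_le:
  assumes "n > 0"
  shows "finite {x :: 'a::{field,finite} alg_closure. x ^ (CARD('a) ^ n) = x}"
    and "card {x :: 'a alg_closure. x ^ (CARD('a) ^ n) = x} \<le> CARD('a) ^ n"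
proof -
  define Q where "Q = CARD('a) ^ n"
  have Q: "Q > 1"
    using card_field_gt_1[where ?'a='a] assms unfolding Q_def by (metis one_less_power)
  define P :: "'a alg_closure poly" where "P = Polynomial.monom 1 Q - Polynomial.monom 1 1"
  have "Polynomial.coeff P Q = 1"
    using Q by (simp add: P_def)
  hence "P \<noteq> 0" by auto
  have "degree P \<le> Q"
    unfolding P_def by (intro degree_diff_le) (use Q in \<open>auto simp: degree_monom_eq\<close>)
  have "{x :: 'a alg_closure. x ^ Q = x} = {x. poly P x = 0}"
    by (auto simp: P_def poly_monom)
  thus "finite {x :: 'a alg_closure. x ^ (CARD('a) ^ n) = x}"
    and "card {x :: 'a alg_closure. x ^ (CARD('a) ^ n) = x} \<le> CARD('a) ^ n"
    using poly_roots_finite[OF \<open>P \<noteq> 0\<close>] card_poly_roots_bound[OF \<open>P \<noteq> 0\<close>] \<open>degree P \<le> Q\<close>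
    by (auto simp: Q_def)
qed

text \<open>The \<open>q\<close> embedded base elements exhaust the at most \<open>q\<close> roots
  of \<open>X^q - X\<close>. This is the descent test used throughout: whatever Frobenius fixes can
  be pulled back to the base field.\<close>

lemma frob_fixed_eq_range_to_ac:
  "{x :: 'a::{field,finite} alg_closure. x ^ CARD('a) = x} = range to_ac"
proof (rule sym, rule card_subset_eq)
  show "finite {x :: 'a alg_closure. x ^ CARD('a) = x}"
    using card_frob_fixed_le(1)[of 1, where ?'a='a] by simp
  show sub: "range to_ac \<subseteq> {x :: 'a alg_closure. x ^ CARD('a) = x}"
    by auto
  have "card (range (to_ac :: 'a \<Rightarrow> _)) = CARD('a)"
    by (simp add: card_image inj_to_ac)
  thus "card (range (to_ac :: 'a \<Rightarrow> _)) = card {x :: 'a alg_closure. x ^ CARD('a) = x}"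
    using card_frob_fixed_le(2)[of 1, where ?'a='a]
      card_mono[OF \<open>finite {x :: 'a alg_closure. x ^ CARD('a) = x}\<close> sub] by simp
qed

lemma frob_fixed_iff: "(x :: 'a::{field,finite} alg_closure) ^ CARD('a) = x \<longleftrightarrow> x \<in> range to_ac"
  using frob_fixed_eq_range_to_ac by blast

section \<open>Multiplicities of roots over an algebraically closed field\<close>

lemma alg_closed_eq_prod_proots:
  fixes p :: "'a::alg_closed_field poly"
  assumes "p \<noteq> 0"
  shows "size (proots p) = degree p"
    and "p = smult (lead_coeff p) (\<Prod>x\<in>#proots p. [:-x, 1:])"
proof -
  obtain A where A: "size A = degree p" "p = smult (lead_coeff p) (\<Prod>x\<in>#A. [:-x, 1:])"
    using alg_closed_imp_factorization[OF assms] by blast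
  have nz: "lead_coeff p \<noteq> 0" using assms by simp
  have "proots (\<Prod>x\<in>#B. [:-x, 1:]) = B" for B :: "'a multiset"
  proof (induction B)
    case (add x B)
    have "(\<Prod>x\<in>#B. [:-x, 1:]) \<noteq> (0 :: 'a poly)"
      by (auto simp: prod_mset_zero_iff)
    thus ?case using add by (simp add: proots_mult del: mult_pCons_left)
  qed simp
  hence "proots p = A"
    by (subst A(2)) (use nz in simp)
  thus "size (proots p) = degree p" "p = smult (lead_coeff p) (\<Prod>x\<in>#proots p. [:-x, 1:])"
    using A by auto
qed

lemma alg_closed_sum_order:
  fixes p :: "'a::alg_closed_field poly"
  assumes "p \<noteq> 0"
  shows "(\<Sum>x | poly p x = 0. Polynomial.order x p) = degree p"
  using alg_closed_eq_prod_proots(1)[OF assms] assms by (simp add: size_multiset_overloaded_eq)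

text \<open>Both polynomials split into linear factors, so divisibility is inclusion of root
  multisets.\<close>

lemma alg_closed_dvd_iff_order:
  fixes p r :: "'a::alg_closed_field poly"
  assumes "p \<noteq> 0" "r \<noteq> 0"
  shows "p dvd r \<longleftrightarrow> (\<forall>x. Polynomial.order x p \<le> Polynomial.order x r)"
proof
  assume "p dvd r"
  thus "\<forall>x. Polynomial.order x p \<le> Polynomial.order x r"
    using assms dvd_imp_order_le by blast
next
  assume "\<forall>x. Polynomial.order x p \<le> Polynomial.order x r"
  hence "proots p \<subseteq># proots r"
    using assms by (simp add: subseteq_mset_def)
  then obtain B where B: "proots r = proots p + B"
    by (metis subset_mset.add_diff_inverse)
  have "(\<Prod>x\<in>#proots p. [:-x, 1:]) dvd (\<Prod>x\<in>#proots r. [:-x, 1:])"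
    by (simp add: B)
  thus "p dvd r"
    using alg_closed_eq_prod_proots(2)[OF assms(1)] alg_closed_eq_prod_proots(2)[OF assms(2)] assms
    by (metis dvd_smult leading_coeff_0_iff smult_dvd)
qed

text \<open>The derivative of \<open>X^Q - X\<close> is \<open>-1\<close>, so its \<open>Q\<close>
  roots are simple. The exact count serves later as the total mass of the trace fibres.\<close>

lemma card_frob_fixed:
  assumes "n > 0"
  shows "card {x :: 'a::{field,finite} alg_closure. x ^ (CARD('a) ^ n) = x} = CARD('a) ^ n"
proof -
  define Q where "Q = CARD('a) ^ n"
  have Q: "Q > 1"
    using card_field_gt_1[where ?'a='a] assms unfolding Q_def by (metis one_less_power)
  have "of_nat CARD('a) = (0 :: 'a alg_closure)"
    by (metis of_nat_card_eq_0 to_ac_0 to_ac_of_nat)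
  hence Q0: "of_nat Q = (0 :: 'a alg_closure)"
    using assms by (simp add: Q_def of_nat_power zero_power)
  define P :: "'a alg_closure poly" where "P = Polynomial.monom 1 Q - Polynomial.monom 1 1"
  have "Polynomial.coeff P Q = 1"
    using Q by (simp add: P_def)
  hence nz: "P \<noteq> 0" by auto
  have "degree P = Q"
    by (intro antisym le_degree) (use \<open>Polynomial.coeff P Q = 1\<close> Q in
      \<open>auto simp: P_def degree_monom_eq intro!: degree_diff_le\<close>)
  have pd: "pderiv P = -1"
    by (simp add: P_def pderiv_diff pderiv_monom Q0)
  have ord: "Polynomial.order x P = 1" if "poly P x = 0" for x
  proof (rule antisym)
    show "1 \<le> Polynomial.order x P"
      using that nz by (simp add: Suc_le_eq order_gt_0_iff)
    show "Polynomial.order x P \<le> 1"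
    proof (rule ccontr)
      assume "\<not> ?thesis"
      hence "[:-x, 1:] ^ 2 dvd P"
        by (subst order_divides) auto
      then obtain R where "P = [:-x, 1:] ^ 2 * R" by (elim dvdE)
      hence P: "P = [:-x, 1:] * ([:-x, 1:] * R)"
        by (simp only: power2_eq_square mult.assoc)
      have "poly (pderiv P) x = 0"
        unfolding P pderiv_mult poly_add poly_mult by simp
      thus False by (simp add: pd)
    qed
  qed
  have "{x :: 'a alg_closure. x ^ Q = x} = {x. poly P x = 0}"
    by (auto simp: P_def poly_monom)
  moreover have "(\<Sum>x | poly P x = 0. Polynomial.order x P) = (\<Sum>x | poly P x = 0. 1)"
    by (intro sum.cong) (auto simp: ord)
  ultimately show ?thesis
    using alg_closed_sum_order[OF nz] \<open>degree P = Q\<close> by (simp add: Q_def)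
qed

section \<open>Polynomials over the base field and norm polynomials of points\<close>

definition rational_poly :: "'a::{field,finite} alg_closure poly \<Rightarrow> bool" where
  "rational_poly f \<longleftrightarrow> (\<forall>i. Polynomial.coeff f i ^ CARD('a) = Polynomial.coeff f i)"

definition frob_poly :: "'a::{field,finite} alg_closure poly \<Rightarrow> 'a alg_closure poly" where
  "frob_poly = map_poly (\<lambda>c. c ^ CARD('a))"

lemma coeff_frob_poly: "Polynomial.coeff (frob_poly f) i = Polynomial.coeff (f :: 'a::{field,finite} alg_closure poly) i ^ CARD('a)"
  by (simp add: frob_poly_def coeff_map_poly)

lemma rational_poly_iff: "rational_poly f \<longleftrightarrow> frob_poly f = f"
  by (simp add: rational_poly_def poly_eq_iff coeff_frob_poly)

lemma frob_poly_mult: "frob_poly (f * g) = frob_poly f * frob_poly (g :: 'a::{field,finite} alg_closure poly)"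
  by (intro poly_eqI)
    (simp add: coeff_frob_poly coeff_mult power_mult_distrib frob_sum[where k=1, simplified])

lemma frob_poly_1 [simp]: "frob_poly 1 = (1 :: 'a::{field,finite} alg_closure poly)"
  by (simp add: frob_poly_def)

lemma frob_poly_prod: "frob_poly (\<Prod>i\<in>A. f i) = (\<Prod>i\<in>A. frob_poly (f i :: 'a::{field,finite} alg_closure poly))"
  by (induction A rule: infinite_finite_induct) (simp_all add: frob_poly_mult)

lemma frob_poly_power: "frob_poly (f ^ n) = frob_poly (f :: 'a::{field,finite} alg_closure poly) ^ n"
  by (induction n) (simp_all add: frob_poly_mult)

lemma frob_poly_linear: "frob_poly [:-x, 1:] = [:-(x ^ CARD('a)), 1 :: 'a::{field,finite} alg_closure:]"
  using frob_minus[of x 1] by (intro poly_eqI) (auto simp: coeff_frob_poly coeff_pCons split: nat.splits)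

lemma rational_poly_mult:
  "rational_poly f \<Longrightarrow> rational_poly g \<Longrightarrow> rational_poly (f * g)"
  by (simp add: rational_poly_iff frob_poly_mult)

lemma rational_poly_mult_cancel:
  assumes "rational_poly (f * g)" "rational_poly f" "f \<noteq> 0"
  shows "rational_poly g"
  using assms by (simp add: rational_poly_iff frob_poly_mult)

text \<open>Frobenius fixes \<open>f\<close> and carries the factor \<open>[:-x, 1:] ^ r\<close> to
  \<open>[:-(x^q), 1:] ^ r\<close>, so multiplicity cannot drop along an orbit. Going once round a
  closed orbit turns the inequality into equality.\<close>

lemma order_frob_le:
  fixes f :: "'a::{field,finite} alg_closure poly"
  assumes "rational_poly f" "f \<noteq> 0"
  shows "Polynomial.order x f \<le> Polynomial.order (x ^ (CARD('a) ^ k)) f"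
proof (induction k)
  case (Suc k)
  define y where "y = x ^ (CARD('a) ^ k)"
  obtain g where g: "f = [:-y, 1:] ^ Polynomial.order y f * g"
    using order_1[of y f] by (elim dvdE)
  have "f = frob_poly f" using assms by (simp add: rational_poly_iff)
  also have "\<dots> = [:-(y ^ CARD('a)), 1:] ^ Polynomial.order y f * frob_poly g"
    by (subst g) (simp add: frob_poly_mult frob_poly_power frob_poly_linear del: mult_pCons_left)
  finally have "[:-(y ^ CARD('a)), 1:] ^ Polynomial.order y f dvd f"
    by (metis dvd_triv_left)
  hence "Polynomial.order y f \<le> Polynomial.order (y ^ CARD('a)) f"
    using assms(2) order_divides by blast
  also have "y ^ CARD('a) = x ^ (CARD('a) ^ Suc k)"
    by (simp add: y_def power_mult[symmetric] mult.commute)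
  finally show ?case using Suc by (simp add: y_def)
qed simp

text \<open>When \<open>x^(q^k) = x\<close>, this is the characteristic polynomial over the base
  field of multiplication by \<open>x\<close> on the extension of degree \<open>k\<close>.
  Conjugates are kept with repetition: for \<open>x\<close> of period \<open>m\<close> it is the
  minimal polynomial to the power \<open>k / m\<close>.\<close>

definition frob_char_poly :: "nat \<Rightarrow> 'a::{field,finite} alg_closure \<Rightarrow> 'a alg_closure poly" where
  "frob_char_poly k x = (\<Prod>i<k. [:-(x ^ (CARD('a) ^ i)), 1:])"

lemma frob_char_poly_nz [simp]: "frob_char_poly k x \<noteq> 0"
  by (simp add: frob_char_poly_def)

lemma degree_frob_char_poly [simp]: "degree (frob_char_poly k x) = k"
  by (simp add: frob_char_poly_def degree_prod_eq_sum_degree)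

lemma monic_frob_char_poly [simp]: "Polynomial.coeff (frob_char_poly k x) k = 1"
proof -
  have "lead_coeff (frob_char_poly k x) = 1"
    by (simp only: frob_char_poly_def lead_coeff_prod) simp
  thus ?thesis by simp
qed

text \<open>Frobenius shifts the conjugates by one index, and the hypothesis closes the
  cycle.\<close>

lemma rational_frob_char_poly:
  fixes x :: "'a::{field,finite} alg_closure"
  assumes "x ^ (CARD('a) ^ k) = x"
  shows "rational_poly (frob_char_poly k x)"
proof (cases k)
  case (Suc j)
  let ?l = "\<lambda>i. [:-(x ^ (CARD('a) ^ i)), 1:]"
  have "frob_poly (frob_char_poly k x) = (\<Prod>i<k. ?l (Suc i))"
    by (simp add: frob_char_poly_def frob_poly_prod frob_poly_linear power_mult[symmetric] mult.commute)
  also have "\<dots> = (\<Prod>i<j. ?l (Suc i)) * ?l k"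
    by (simp add: Suc)
  also have "?l k = ?l 0"
    using assms by simp
  also have "(\<Prod>i<j. ?l (Suc i)) * ?l 0 = (\<Prod>i<k. ?l i)"
    by (simp only: Suc prod.lessThan_Suc_shift mult.commute)
  finally show ?thesis
    by (simp add: rational_poly_iff frob_char_poly_def)
qed (simp add: frob_char_poly_def rational_poly_iff)

lemma frob_char_poly_mult_period:
  fixes x :: "'a::{field,finite} alg_closure"
  assumes "x ^ (CARD('a) ^ m) = x"
  shows "frob_char_poly (m * j) x = frob_char_poly m x ^ j" "x ^ (CARD('a) ^ (m * j)) = x"
proof -
  show per: "x ^ (CARD('a) ^ (m * j)) = x" for j
    by (induction j) (simp_all add: assms power_add power_mult)
  show "frob_char_poly (m * j) x = frob_char_poly m x ^ j"
  proof (induction j)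
    case (Suc j)
    have "frob_char_poly (m * Suc j) x = (\<Prod>i\<in>{..<m*j} \<union> {m*j..<m*j+m}. [:-(x ^ (CARD('a) ^ i)), 1:])"
      unfolding frob_char_poly_def by (rule prod.cong) auto
    also have "\<dots> = frob_char_poly (m * j) x * (\<Prod>i\<in>{m*j..<m*j+m}. [:-(x ^ (CARD('a) ^ i)), 1:])"
      unfolding frob_char_poly_def by (intro prod.union_disjoint) auto
    also have "(\<Prod>i\<in>{m*j..<m*j+m}. [:-(x ^ (CARD('a) ^ i)), 1:]) =
       (\<Prod>i<m. [:-(x ^ (CARD('a) ^ (m*j + i))), 1:])"
      by (rule prod.reindex_bij_witness[of _ "\<lambda>i. m * j + i" "\<lambda>i. i - m * j"]) auto
    also have "\<dots> = frob_char_poly m x"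
      by (simp add: frob_char_poly_def frob_compose[symmetric] per)
    finally show ?case using Suc by simp
  qed (simp add: frob_char_poly_def)
qed

lemma order_prod_linear:
  fixes g :: "nat \<Rightarrow> 'b::idom"
  shows "Polynomial.order y (\<Prod>i<k. [:-g i, 1:]) = card {i. i < k \<and> g i = y}"
proof (induction k)
  case (Suc k)
  have nz: "(\<Prod>i<k. [:-g i, 1:]) * [:-g k, 1:] \<noteq> 0" by (simp del: mult_pCons_right)
  have o: "Polynomial.order y [:-g k, 1:] = (if g k = y then 1 else 0)"
  proof (cases "g k = y")
    case True
    thus ?thesis using order_power_n_n[of y 1] by simp
  qed (simp add: order_0I)
  have "{i. i < Suc k \<and> g i = y} = (if g k = y then insert k {i. i < k \<and> g i = y} else {i. i < k \<and> g i = y})"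
    by (auto simp: less_Suc_eq)
  thus ?case
    unfolding prod.lessThan_Suc order_mult[OF nz] o using Suc by simp
qed simp

text \<open>With \<open>m\<close> the period of \<open>x\<close> under Frobenius and \<open>M\<close> its minimal polynomial, the admissible
  \<open>k\<close> are the \<open>m * j\<close> with \<open>M ^ j dvd f\<close>.\<close>
lemma card_frob_char_poly_dvd:
  fixes f :: "'a::{field,finite} alg_closure poly"
  assumes f: "rational_poly f" "f \<noteq> 0"
  shows "card {k. k > 0 \<and> x ^ (CARD('a) ^ k) = x \<and> frob_char_poly k x dvd f} = Polynomial.order x f"
    (is "card ?S = _")
proof (cases "poly f x = 0")
  case False
  have "\<not> frob_char_poly k x dvd f" if "k > 0" for k
  proof
    assume "frob_char_poly k x dvd f"
    moreover have "poly (frob_char_poly k x) x = 0"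
      using that by (auto simp: frob_char_poly_def poly_prod intro!: bexI[of _ 0])
    ultimately show False using False by (metis dvd_def mult_zero_left poly_mult)
  qed
  hence "?S = {}" by auto
  thus ?thesis using order_0I[OF False] by (metis card.empty)
next
  case True
  let ?q = "CARD('a)"
  have root: "poly f (x ^ (?q ^ i)) = 0" for i
    using order_frob_le[OF f, of x i] True f(2) by (metis le_zero_eq order_root)
  \<comment> \<open>The orbit stays inside the finitely many roots of \<open>f\<close>, so it
    repeats; injectivity of Frobenius then moves the repetition back to \<open>x\<close>
    itself.\<close>
  have "\<not> inj (\<lambda>i. x ^ (?q ^ i))"
  proof
    assume "inj (\<lambda>i. x ^ (?q ^ i))"
    moreover have "finite (range (\<lambda>i. x ^ (?q ^ i)))"
      by (rule finite_subset[OF _ poly_roots_finite[OF f(2)]]) (use root in auto)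
    ultimately show False
      using finite_imageD infinite_UNIV_nat by blast
  qed
  then obtain i j where ij: "i < j" "x ^ (?q ^ i) = x ^ (?q ^ j)"
    unfolding inj_def by (metis linorder_neqE_nat)
  have "x ^ (?q ^ (j - i)) = x"
  proof (rule frob_inject[of _ i])
    show "(x ^ (?q ^ (j - i))) ^ (?q ^ i) = x ^ (?q ^ i)"
      using ij by (simp add: frob_compose)
  qed
  hence ex: "\<exists>k>0. x ^ (?q ^ k) = x" using ij by (intro exI[of _ "j - i"]) auto
  define m where "m = (LEAST k. k > 0 \<and> x ^ (?q ^ k) = x)"
  have m: "m > 0" "x ^ (?q ^ m) = x"
    using LeastI_ex[OF ex] by (auto simp: m_def)
  have least: "m \<le> k" if "k > 0" "x ^ (?q ^ k) = x" for k
    unfolding m_def by (rule Least_le) (use that in auto)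
  have per: "x ^ (?q ^ k) = x \<longleftrightarrow> m dvd k" for k
  proof
    assume "m dvd k"
    thus "x ^ (?q ^ k) = x"
      using frob_char_poly_mult_period(2)[OF m(2)] by auto
  next
    assume k: "x ^ (?q ^ k) = x"
    have "x ^ (?q ^ k) = (x ^ (?q ^ (m * (k div m)))) ^ (?q ^ (k mod m))"
      by (subst frob_compose) simp
    hence "x ^ (?q ^ (k mod m)) = x"
      unfolding frob_char_poly_mult_period(2)[OF m(2)] k by (rule sym)
    hence "k mod m = 0"
      using least[of "k mod m"] m(1) by (metis mod_less_divisor neq0_conv not_le)
    thus "m dvd k" by auto
  qed
  define r where "r = Polynomial.order x f"
  have ord: "Polynomial.order (x ^ (?q ^ i)) f = r" if "i < m" for i
  proof (rule antisym)
    have "Polynomial.order (x ^ (?q ^ i)) f \<le> Polynomial.order ((x ^ (?q ^ i)) ^ (?q ^ (m - i))) f"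
      by (rule order_frob_le[OF f])
    also have "(x ^ (?q ^ i)) ^ (?q ^ (m - i)) = x"
      using that m by (simp add: frob_compose)
    finally show "Polynomial.order (x ^ (?q ^ i)) f \<le> r" by (simp add: r_def)
    show "r \<le> Polynomial.order (x ^ (?q ^ i)) f"
      unfolding r_def by (rule order_frob_le[OF f])
  qed
  have inj: "i = j" if "i < m" "j < m" "x ^ (?q ^ i) = x ^ (?q ^ j)" for i j
  proof -
    have *: False if "i < j" "j < m" "x ^ (?q ^ i) = x ^ (?q ^ j)" for i j
    proof -
      have "x ^ (?q ^ (j - i)) = x"
      proof (rule frob_inject[of _ i])
        show "(x ^ (?q ^ (j - i))) ^ (?q ^ i) = x ^ (?q ^ i)"
          using that by (simp add: frob_compose)
      qed
      thus False using least[of "j - i"] that by simp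
    qed
    show ?thesis using *[of i j] *[of j i] that by (metis linorder_neqE_nat)
  qed
  have ordM: "Polynomial.order y (frob_char_poly m x ^ j) = j * card {i. i < m \<and> x ^ (?q ^ i) = y}" for y j
    using count_proots[of "frob_char_poly m x ^ j" y] count_proots[of "frob_char_poly m x" y]
    by (simp add: proots_power) (simp add: frob_char_poly_def order_prod_linear)
  \<comment> \<open>The minimal polynomial has the points of the orbit as simple roots, and
    \<open>f\<close> has order \<open>r\<close> at each of them, so its \<open>j\<close>-th power
    divides \<open>f\<close> exactly for \<open>j \<le> r\<close>.\<close>
  have dvd: "frob_char_poly (m * j) x dvd f \<longleftrightarrow> j \<le> r" for j
  proof -
    have "frob_char_poly (m * j) x dvd f \<longleftrightarrow>
        (\<forall>y. j * card {i. i < m \<and> x ^ (?q ^ i) = y} \<le> Polynomial.order y f)"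
      using f(2) by (subst frob_char_poly_mult_period(1)[OF m(2)], subst alg_closed_dvd_iff_order) (auto simp: ordM)
    also have "\<dots> \<longleftrightarrow> j \<le> r"
    proof
      assume *: "\<forall>y. j * card {i. i < m \<and> x ^ (?q ^ i) = y} \<le> Polynomial.order y f"
      have "{i. i < m \<and> x ^ (?q ^ i) = x} = {0}"
        using m(1) by (auto dest: inj[of _ 0])
      thus "j \<le> r" using *[rule_format, of x] by (simp add: r_def)
    next
      assume j: "j \<le> r"
      show "\<forall>y. j * card {i. i < m \<and> x ^ (?q ^ i) = y} \<le> Polynomial.order y f"
      proof
        fix y
        show "j * card {i. i < m \<and> x ^ (?q ^ i) = y} \<le> Polynomial.order y f"
        proof (cases "\<exists>i<m. x ^ (?q ^ i) = y")
          case True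
          then obtain i where i: "i < m" "x ^ (?q ^ i) = y" by blast
          hence "{i. i < m \<and> x ^ (?q ^ i) = y} = {i}" by (auto dest: inj[of _ i])
          thus ?thesis using j ord[OF i(1)] i by simp
        next
          case False
          hence "{i. i < m \<and> x ^ (?q ^ i) = y} = {}" by auto
          thus ?thesis by (simp only: card.empty mult_0_right le0)
        qed
      qed
    qed
    finally show ?thesis .
  qed
  have "?S = (\<lambda>j. m * j) ` {1..r}"
  proof (intro equalityI subsetI)
    fix k assume "k \<in> ?S"
    hence k: "k > 0" "m dvd k" "frob_char_poly k x dvd f" by (simp_all add: per)
    then obtain j where j: "k = m * j" by (auto simp: dvd_def)
    with k have "j \<in> {1..r}" using dvd[of j] by (cases j) auto
    thus "k \<in> (\<lambda>j. m * j) ` {1..r}" using j by blast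
  next
    fix k assume "k \<in> (\<lambda>j. m * j) ` {1..r}"
    then obtain j where "k = m * j" "1 \<le> j" "j \<le> r" by (metis atLeastAtMost_iff imageE)
    thus "k \<in> ?S" using m(1) by (simp add: per dvd)
  qed
  thus ?thesis
    using m(1) by (simp add: card_image inj_on_def r_def)
qed

section \<open>The L-function of a Kloosterman sum\<close>

locale nontrivial_add_char =
  fixes \<psi> :: "'a::{field,finite} \<Rightarrow> complex"
  assumes add: "\<psi> (x + y) = \<psi> x * \<psi> y"
    and norm_eq_1 [simp]: "cmod (\<psi> x) = 1"
    and nontrivial: "\<exists>x. \<psi> x \<noteq> 1"
begin

lemma nonzero [simp]: "\<psi> x \<noteq> 0"
  using norm_eq_1[of x] by (metis norm_zero zero_neq_one)

lemma zero [simp]: "\<psi> 0 = 1"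
  using add[of 0 0] by simp

lemma uminus: "\<psi> (-x) = cnj (\<psi> x)"
proof -
  have "\<psi> x * \<psi> (-x) = \<psi> x * cnj (\<psi> x)"
    using add[of x "-x"] by (simp add: complex_norm_square[symmetric])
  thus ?thesis by simp
qed

lemma sum_eq_prod: "\<psi> (\<Sum>i\<in>A. f i) = (\<Prod>i\<in>A. \<psi> (f i))"
  by (induction A rule: infinite_finite_induct) (simp_all add: add)

lemma sum_UNIV_eq_0: "(\<Sum>x\<in>UNIV. \<psi> x) = 0"
proof -
  obtain s where s: "\<psi> s \<noteq> 1" using nontrivial by blast
  have "(\<Sum>x\<in>UNIV. \<psi> x) = (\<Sum>x\<in>UNIV. \<psi> (x + s))"
    by (rule sum.reindex_bij_witness[of _ "\<lambda>x. x + s" "\<lambda>x. x - s"]) auto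
  also have "\<dots> = (\<Sum>x\<in>UNIV. \<psi> x) * \<psi> s"
    by (simp add: add sum_distrib_right)
  finally show ?thesis using s by simp
qed

lemma sum_mult_UNIV: "(\<Sum>x\<in>UNIV. \<psi> (c * x)) = (if c = 0 then of_nat CARD('a) else 0)"
proof (cases "c = 0")
  case False
  have "(\<Sum>x\<in>UNIV. \<psi> (c * x)) = (\<Sum>x\<in>UNIV. \<psi> x)"
    by (rule sum.reindex_bij_witness[of _ "\<lambda>x. x / c" "\<lambda>x. c * x"]) (use False in auto)
  thus ?thesis using False sum_UNIV_eq_0 by simp
qed simp

lemma twist:
  assumes "c \<noteq> 0"
  shows "nontrivial_add_char (\<lambda>x. \<psi> (c * x))"
proof
  obtain s where "\<psi> s \<noteq> 1" using nontrivial by blast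
  thus "\<exists>x. \<psi> (c * x) \<noteq> 1" using assms by (intro exI[of _ "s / c"]) auto
qed (auto simp: add distrib_left)

end

section \<open>Characters on monic polynomials\<close>

definition monic_rational :: "nat \<Rightarrow> 'a::{field,finite} alg_closure poly set" where
  "monic_rational n = {f. rational_poly f \<and> degree f = n \<and> lead_coeff f = 1}"

lemma finite_monic_rational: "finite (monic_rational n :: 'a::{field,finite} alg_closure poly set)"
proof -
  let ?X = "{xs. set xs \<subseteq> range (to_ac :: 'a \<Rightarrow> _) \<and> length xs \<le> Suc n}"
  have "monic_rational n \<subseteq> Poly ` ?X"
  proof
    fix f :: "'a alg_closure poly" assume f: "f \<in> monic_rational n"
    have "set (coeffs f) \<subseteq> range to_ac"
      using f by (auto simp: coeffs_def monic_rational_def rational_poly_def frob_fixed_iff simp del: upt_Suc)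
    moreover have "length (coeffs f) \<le> Suc n"
      using f by (auto simp: coeffs_def monic_rational_def)
    ultimately show "f \<in> Poly ` ?X"
      by (intro image_eqI[of _ _ "coeffs f"]) auto
  qed
  moreover have "finite ?X"
    by (intro finite_lists_length_le) auto
  ultimately show ?thesis
    using finite_subset by blast
qed

text \<open>The value of \<open>f'/f\<close> at 0. For a product of factors \<open>X - x_i\<close>
  it is minus the sum of the \<open>1 / x_i\<close>, and for the reflected polynomial minus the sum
  of the \<open>x_i\<close>. Both root sums are thus read off from two coefficients and are additive
  in \<open>f\<close>.\<close>

definition log_deriv_0 :: "'a::field poly \<Rightarrow> 'a" where
  "log_deriv_0 f = Polynomial.coeff f 1 / Polynomial.coeff f 0"

lemma log_deriv_0_mult:
  assumes "Polynomial.coeff f 0 \<noteq> 0" "Polynomial.coeff g 0 \<noteq> 0"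
  shows "log_deriv_0 (f * g) = log_deriv_0 f + log_deriv_0 g"
  using assms by (simp add: log_deriv_0_def coeff_mult field_simps)

lemma log_deriv_0_prod:
  assumes "\<And>i. i \<in> A \<Longrightarrow> Polynomial.coeff (f i) 0 \<noteq> 0"
  shows "log_deriv_0 (\<Prod>i\<in>A. f i) = (\<Sum>i\<in>A. log_deriv_0 (f i))"
  using assms
proof (induction A rule: infinite_finite_induct)
  case (insert i A)
  have "Polynomial.coeff (\<Prod>i\<in>A. f i) 0 \<noteq> 0"
    using insert by (simp add: poly_0_coeff_0[symmetric] poly_prod)
  thus ?case using insert by (simp add: log_deriv_0_mult)
qed (simp_all add: log_deriv_0_def)

lemma log_deriv_0_rational:
  assumes "rational_poly f"
  shows "log_deriv_0 f \<in> range to_ac" "log_deriv_0 (reflect_poly f) \<in> range to_ac"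
  using assms unfolding rational_poly_def log_deriv_0_def
  by (auto simp: frob_fixed_iff[symmetric] power_divide coeff_reflect_poly power_0_left)

definition frob_trace :: "nat \<Rightarrow> 'a::{field,finite} alg_closure \<Rightarrow> 'a alg_closure" where
  "frob_trace k z = (\<Sum>i<k. z ^ (CARD('a) ^ i))"

lemma frob_trace_rational:
  fixes z :: "'a::{field,finite} alg_closure"
  assumes "z ^ (CARD('a) ^ k) = z"
  shows "frob_trace k z \<in> range to_ac"
proof (cases k)
  case (Suc j)
  have "frob_trace k z ^ CARD('a) = (\<Sum>i<k. z ^ (CARD('a) ^ Suc i))"
    unfolding frob_trace_def using frob_sum[of "\<lambda>i. z ^ (CARD('a) ^ i)" "{..<k}" 1]
    by (simp add: power_mult[symmetric] mult.commute)
  also have "\<dots> = (\<Sum>i<j. z ^ (CARD('a) ^ Suc i)) + z ^ (CARD('a) ^ 0)"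
    using assms by (simp add: Suc)
  also have "\<dots> = frob_trace k z"
    unfolding frob_trace_def Suc sum.lessThan_Suc_shift by simp
  finally show ?thesis by (simp add: frob_fixed_iff)
qed (auto simp: frob_trace_def intro!: image_eqI[of _ _ 0])

context nontrivial_add_char
begin

definition kloosterman :: "'a \<Rightarrow> complex" where
  "kloosterman a = (\<Sum>x\<in>UNIV - {0}. \<psi> (x + a / x))"

text \<open>The sum over the extension of degree \<open>k\<close>, with the character composed with
  the trace. The trace of a point of that extension is Frobenius-fixed, so \<open>of_ac\<close> is
  applied only where it inverts \<open>to_ac\<close>.\<close>

definition kloosterman_ext :: "'a \<Rightarrow> nat \<Rightarrow> complex" where
  "kloosterman_ext a k =
     (\<Sum>x | x ^ (CARD('a) ^ k) = x \<and> x \<noteq> 0. \<psi> (of_ac (frob_trace k (x + to_ac a / x))))"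

text \<open>For \<open>f\<close> with nonzero roots \<open>x_i\<close> this is \<open>\<psi>\<close>
  of the sum of the \<open>x_i + a / x_i\<close>; the minus signs undo those of the logarithmic
  derivatives. The value 0 on multiples of \<open>X\<close> excludes the pole at 0 and preserves
  multiplicativity.\<close>

definition poly_char :: "'a \<Rightarrow> 'a alg_closure poly \<Rightarrow> complex" where
  "poly_char a f = (if Polynomial.coeff f 0 = 0 then 0
     else \<psi> (of_ac (- log_deriv_0 (reflect_poly f) - to_ac a * log_deriv_0 f)))"

definition L_coeff :: "'a \<Rightarrow> nat \<Rightarrow> complex" where
  "L_coeff a n = (\<Sum>f\<in>monic_rational n. poly_char a f)"

lemma poly_char_mult:
  assumes "rational_poly f" "rational_poly g"
  shows "poly_char a (f * g) = poly_char a f * poly_char a g"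
proof (cases "Polynomial.coeff f 0 = 0 \<or> Polynomial.coeff g 0 = 0")
  case True
  thus ?thesis by (auto simp: poly_char_def coeff_mult_0)
next
  case False
  hence nz: "f \<noteq> 0" "g \<noteq> 0" by auto
  obtain u u' v v' where uv: "log_deriv_0 f = to_ac u" "log_deriv_0 (reflect_poly f) = to_ac u'"
     "log_deriv_0 g = to_ac v" "log_deriv_0 (reflect_poly g) = to_ac v'"
    using log_deriv_0_rational[OF assms(1)] log_deriv_0_rational[OF assms(2)] by blast
  have "log_deriv_0 (f * g) = to_ac (u + v)"
    using False by (simp add: log_deriv_0_mult uv)
  moreover have "log_deriv_0 (reflect_poly (f * g)) = to_ac (u' + v')"
    using nz by (simp add: log_deriv_0_mult reflect_poly_mult uv)
  moreover have "- to_ac x - to_ac a * to_ac y = to_ac (- x - a * y)" for x y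
    by simp
  ultimately have "poly_char a (f * g) = \<psi> (- (u' + v') - a * (u + v))"
    using False by (simp add: poly_char_def coeff_mult_0 del: to_ac_add to_ac_diff to_ac_minus to_ac_mult)
  moreover have "poly_char a f = \<psi> (- u' - a * u)" "poly_char a g = \<psi> (- v' - a * v)"
    using False \<open>\<And>x y. - to_ac x - to_ac a * to_ac y = to_ac (- x - a * y)\<close>
    by (simp_all add: poly_char_def uv del: to_ac_diff to_ac_minus to_ac_mult)
  moreover have "- (u' + v') - a * (u + v) = (- u' - a * u) + (- v' - a * v)"
    by (simp add: algebra_simps)
  ultimately show ?thesis by (simp only: add)
qed

lemma poly_char_frob_char_poly:
  fixes x :: "'a alg_closure"
  assumes "k > 0"
  shows "poly_char a (frob_char_poly k x) =
    (if x = 0 then 0 else \<psi> (of_ac (frob_trace k (x + to_ac a / x))))"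
proof (cases "x = 0")
  case True
  have "\<exists>i<k. (0::'a alg_closure) ^ (CARD('a) ^ i) = 0"
    using assms by (intro exI[of _ 0]) simp
  hence "Polynomial.coeff (frob_char_poly k x) 0 = 0"
    using True by (auto simp: frob_char_poly_def poly_0_coeff_0[symmetric] poly_prod)
  thus ?thesis using True by (simp add: poly_char_def)
next
  case False
  have "Polynomial.coeff (frob_char_poly k x) 0 \<noteq> 0"
    using False by (auto simp: frob_char_poly_def poly_0_coeff_0[symmetric] poly_prod)
  moreover have "log_deriv_0 (frob_char_poly k x) = (\<Sum>i<k. - (1 / x ^ (CARD('a) ^ i)))"
    unfolding frob_char_poly_def using False
    by (subst log_deriv_0_prod) (auto simp: log_deriv_0_def)
  moreover have "log_deriv_0 (reflect_poly (frob_char_poly k x)) = (\<Sum>i<k. - (x ^ (CARD('a) ^ i)))"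
    unfolding frob_char_poly_def reflect_poly_prod using False
    by (subst log_deriv_0_prod) (auto simp: log_deriv_0_def coeff_reflect_poly)
  moreover have "frob_trace k (x + to_ac a / x) =
      (\<Sum>i<k. x ^ (CARD('a) ^ i)) + to_ac a * (\<Sum>i<k. 1 / x ^ (CARD('a) ^ i))"
    by (simp add: frob_trace_def frob_add power_divide sum.distrib sum_distrib_left)
  ultimately show ?thesis
    using False by (simp add: poly_char_def sum_negf)
qed

text \<open>Counting by \<open>x\<close> first, each root contributes its multiplicity, and over the
  closure the multiplicities add up to the degree. This stands in for unique factorisation in the
  Euler product.\<close>

lemma card_frob_char_poly_dvd_eq_degree:
  fixes f :: "'a alg_closure poly"
  assumes f: "f \<in> monic_rational n"
  shows "card (SIGMA k:{1..n}. {x. x ^ (CARD('a) ^ k) = x \<and> frob_char_poly k x dvd f}) = n"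
    (is "card ?A = n")
proof -
  let ?B = "\<lambda>x. {k. k > 0 \<and> x ^ (CARD('a) ^ k) = x \<and> frob_char_poly k x dvd f}"
  have f': "rational_poly f" "f \<noteq> 0" "degree f = n"
    using f by (auto simp: monic_rational_def)
  have "?A = (\<lambda>(x, k). (k, x)) ` (SIGMA x:{x. poly f x = 0}. ?B x)"
  proof -
    have "k \<le> n" if "frob_char_poly k x dvd f" for k x
      using dvd_imp_degree_le[OF that f'(2)] f'(3) by simp
    moreover have "poly f x = 0" if "frob_char_poly k x dvd f" "k > 0" for k x
    proof -
      have "poly (frob_char_poly k x) x = 0"
        using that by (auto simp: frob_char_poly_def poly_prod intro!: bexI[of _ 0])
      thus ?thesis using that by (metis dvd_def mult_zero_left poly_mult)
    qed
    ultimately show ?thesis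
      by (auto simp: image_iff Suc_le_eq)
  qed
  hence "card ?A = card (SIGMA x:{x. poly f x = 0}. ?B x)"
    by (simp add: card_image inj_on_def split_beta prod_eq_iff)
  also have "\<dots> = (\<Sum>x | poly f x = 0. card (?B x))"
  proof (rule card_SigmaI)
    show "finite {x. poly f x = 0}" using f'(2) poly_roots_finite by blast
    have "finite (?B x)" if "poly f x = 0" for x
    proof (rule card_ge_0_finite)
      show "card (?B x) > 0"
        using that f' by (simp add: card_frob_char_poly_dvd order_gt_0_iff)
    qed
    thus "\<forall>x\<in>{x. poly f x = 0}. finite (?B x)" by auto
  qed
  also have "\<dots> = n"
    using f' by (simp add: card_frob_char_poly_dvd alg_closed_sum_order)
  finally show ?thesis .
qed

text \<open>Newton's identity for the Euler product of the L-function, that is the coefficient form of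
  \<open>T L'(T) = L(T) * (\<Sum>k. S k * T^k)\<close>.\<close>
lemma L_coeff_newton:
  "of_nat n * L_coeff a n = (\<Sum>k=1..n. kloosterman_ext a k * L_coeff a (n - k))"
proof -
  let ?q = "CARD('a)"
  let ?F = "\<lambda>k. {x :: 'a alg_closure. x ^ (?q ^ k) = x}"
  have fin: "finite (?F k)" if "k \<in> {1..n}" for k
    using card_frob_fixed_le(1)[of k, where ?'a='a] that by simp
  have "of_nat n * L_coeff a n = (\<Sum>f\<in>monic_rational n. of_nat n * poly_char a f)"
    by (simp add: L_coeff_def sum_distrib_left)
  also have "\<dots> = (\<Sum>f\<in>monic_rational n. \<Sum>k=1..n. \<Sum>x\<in>?F k.
      if frob_char_poly k x dvd f then poly_char a f else 0)"
  proof (rule sum.cong)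
    fix f :: "'a alg_closure poly" assume f: "f \<in> monic_rational n"
    \<comment> \<open>The factor \<open>n\<close> becomes the number of pairs \<open>(k, x)\<close>
      whose norm polynomial divides \<open>f\<close>. After exchanging the sums, \<open>f\<close>
      runs over the multiples of one norm polynomial, and dividing by it leaves
      \<open>L_coeff a (n - k)\<close>.\<close>
    have "of_nat n = (\<Sum>k=1..n. (of_nat (card {x. x ^ (?q ^ k) = x \<and> frob_char_poly k x dvd f}) :: complex))"
      by (subst (1) card_frob_char_poly_dvd_eq_degree[OF f, symmetric], subst card_SigmaI)
        (auto intro: finite_subset[OF _ fin])
    hence "of_nat n * poly_char a f = (\<Sum>k=1..n. \<Sum>x | x ^ (?q ^ k) = x \<and> frob_char_poly k x dvd f. poly_char a f)"
      by (simp add: sum_distrib_right)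
    also have "\<dots> = (\<Sum>k=1..n. \<Sum>x\<in>?F k. if frob_char_poly k x dvd f then poly_char a f else 0)"
      by (intro sum.cong refl sum.mono_neutral_cong_left fin) auto
    finally show "of_nat n * poly_char a f = \<dots>" .
  qed simp
  also have "\<dots> = (\<Sum>k=1..n. \<Sum>x\<in>?F k. \<Sum>f\<in>monic_rational n.
      if frob_char_poly k x dvd f then poly_char a f else 0)"
    by (subst sum.swap, intro sum.cong refl, subst sum.swap, rule refl)
  also have "\<dots> = (\<Sum>k=1..n. \<Sum>x\<in>?F k. poly_char a (frob_char_poly k x) * L_coeff a (n - k))"
  proof (intro sum.cong refl)
    fix k x assume k: "k \<in> {1..n}" and x: "x \<in> ?F k"
    let ?N = "frob_char_poly k x"
    have rat: "rational_poly ?N" using x rational_frob_char_poly by auto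
    have "(\<Sum>f\<in>monic_rational n. if ?N dvd f then poly_char a f else 0) =
        (\<Sum>f\<in>{f \<in> monic_rational n. ?N dvd f}. poly_char a f)"
      by (rule sum.inter_filter[symmetric]) (rule finite_monic_rational)
    also have "\<dots> = (\<Sum>g\<in>monic_rational (n - k). poly_char a (?N * g))"
    proof (rule sum.reindex_bij_witness[of _ "\<lambda>g. ?N * g" "\<lambda>f. f div ?N"])
      fix f assume "f \<in> {f \<in> monic_rational n. ?N dvd f}"
      then obtain g where g: "f = ?N * g" "f \<in> monic_rational n" by (auto elim: dvdE)
      show "?N * (f div ?N) = f" "poly_char a (?N * (f div ?N)) = poly_char a f" by (simp_all add: g(1))
      have "g \<noteq> 0" using g by (auto simp: monic_rational_def)
      have f: "rational_poly f" "degree f = n" "lead_coeff f = 1"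
        using g(2) by (auto simp: monic_rational_def)
      have "lead_coeff g = 1"
        using f(3) unfolding g(1) lead_coeff_mult by simp
      moreover have "k + degree g = n"
        using f(2) \<open>g \<noteq> 0\<close> unfolding g(1) by (simp add: degree_mult_eq)
      moreover have "rational_poly g"
        using rational_poly_mult_cancel[of ?N g] f(1) rat unfolding g(1) by simp
      ultimately have "g \<in> monic_rational (n - k)"
        unfolding monic_rational_def by auto
      thus "f div ?N \<in> monic_rational (n - k)" by (simp add: g(1))
    next
      fix g :: "'a alg_closure poly" assume g: "g \<in> monic_rational (n - k)"
      hence "g \<noteq> 0" by (auto simp: monic_rational_def)
      show "?N * g div ?N = g" by simp
      have "lead_coeff (?N * g) = 1"
        using g unfolding lead_coeff_mult by (auto simp: monic_rational_def)
      thus "?N * g \<in> {f \<in> monic_rational n. ?N dvd f}"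
        using g rat k \<open>g \<noteq> 0\<close>
        by (simp add: monic_rational_def degree_mult_eq rational_poly_mult)
    qed
    also have "\<dots> = (\<Sum>g\<in>monic_rational (n - k). poly_char a ?N * poly_char a g)"
      by (intro sum.cong refl poly_char_mult rat) (auto simp: monic_rational_def)
    finally show "(\<Sum>f\<in>monic_rational n. if ?N dvd f then poly_char a f else 0) = poly_char a ?N * L_coeff a (n - k)"
      by (simp add: L_coeff_def sum_distrib_left)
  qed
  also have "\<dots> = (\<Sum>k=1..n. kloosterman_ext a k * L_coeff a (n - k))"
  proof (intro sum.cong refl)
    fix k assume k: "k \<in> {1..n}"
    have "(\<Sum>x\<in>?F k. poly_char a (frob_char_poly k x)) = kloosterman_ext a k"
      unfolding kloosterman_ext_def using k fin[OF k]
      by (intro sum.mono_neutral_cong_right) (auto simp: poly_char_frob_char_poly)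
    thus "(\<Sum>x\<in>?F k. poly_char a (frob_char_poly k x) * L_coeff a (n - k)) =
        kloosterman_ext a k * L_coeff a (n - k)"
      by (simp add: sum_distrib_right[symmetric])
  qed
  finally show ?thesis .
qed

lemma L_coeff_0: "L_coeff a 0 = 1"
proof -
  have "monic_rational 0 = {1 :: 'a alg_closure poly}"
  proof -
    have "f = 1" if "degree f = 0" "lead_coeff f = 1" for f :: "'a alg_closure poly"
      using that by (metis degree_eq_zeroE lead_coeff_pCons(2) one_pCons)
    thus ?thesis by (auto simp: monic_rational_def rational_poly_iff)
  qed
  thus ?thesis by (simp add: L_coeff_def poly_char_def log_deriv_0_def)
qed

lemma L_coeff_1: "L_coeff a 1 = kloosterman a"
proof -
  have "monic_rational 1 = (\<lambda>c. [:- to_ac c, 1:]) ` (UNIV :: 'a set)"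
  proof (intro equalityI subsetI)
    fix f :: "'a alg_closure poly" assume f: "f \<in> monic_rational 1"
    have "f = [:Polynomial.coeff f 0, 1:]"
      using f by (intro poly_eqI)
        (auto simp: monic_rational_def coeff_pCons coeff_eq_0 split: nat.splits)
    moreover have "Polynomial.coeff f 0 \<in> range to_ac"
      using f by (auto simp: monic_rational_def rational_poly_def frob_fixed_iff)
    ultimately obtain c where "f = [:to_ac c, 1:]" by (metis rangeE)
    thus "f \<in> (\<lambda>c. [:- to_ac c, 1:]) ` (UNIV :: 'a set)"
      by (intro image_eqI[of _ _ "- c"]) auto
  next
    fix f assume "f \<in> (\<lambda>c. [:- to_ac c, 1:]) ` (UNIV :: 'a set)"
    thus "f \<in> monic_rational 1"
      by (auto simp: monic_rational_def rational_poly_iff frob_poly_linear)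
  qed
  moreover have "inj (\<lambda>c :: 'a. [:- to_ac c, 1:])"
    by (auto simp: inj_def)
  ultimately have "L_coeff a 1 = (\<Sum>c\<in>UNIV. poly_char a [:- to_ac c, 1:])"
    by (simp add: L_coeff_def sum.reindex)
  also have "\<dots> = (\<Sum>c\<in>UNIV. if c = 0 then 0 else \<psi> (c + a / c))"
  proof (rule sum.cong)
    fix c
    have "poly_char a [:- to_ac c, 1:] = poly_char a (frob_char_poly 1 (to_ac c))"
      by (simp add: frob_char_poly_def)
    also have "\<dots> = (if c = 0 then 0 else \<psi> (of_ac (to_ac (c + a / c))))"
      unfolding to_ac_add to_ac_divide by (subst poly_char_frob_char_poly) (auto simp: frob_trace_def)
    finally show "poly_char a [:- to_ac c, 1:] = (if c = 0 then 0 else \<psi> (c + a / c))"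
      unfolding of_ac_to_ac .
  qed simp
  also have "\<dots> = kloosterman a"
    unfolding kloosterman_def by (intro sum.mono_neutral_cong_right) auto
  finally show ?thesis .
qed

text \<open>For \<open>X^2 - s X + p\<close> the sum of the roots is \<open>s\<close> and that of
  their reciprocals \<open>s / p\<close>, so the value is \<open>\<psi> ((1 + a / p) * s)\<close>.
  Summing over \<open>s\<close> kills everything but \<open>p = -a\<close>, a nonzero constant term
  by hypothesis, and that contributes \<open>q\<close>.\<close>

lemma L_coeff_2:
  assumes "a \<noteq> 0"
  shows "L_coeff a 2 = of_nat CARD('a)"
proof -
  let ?P = "\<lambda>(p, s). [:to_ac p, - to_ac s, 1:]"
  have "monic_rational 2 = ?P ` (UNIV :: ('a \<times> 'a) set)"
  proof (intro equalityI subsetI)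
    fix f :: "'a alg_closure poly" assume f: "f \<in> monic_rational 2"
    have "f = [:Polynomial.coeff f 0, Polynomial.coeff f 1, 1:]"
      using f by (intro poly_eqI)
        (auto simp: monic_rational_def coeff_pCons numeral_2_eq_2 coeff_eq_0 split: nat.splits)
    moreover have "Polynomial.coeff f 0 \<in> range to_ac" "Polynomial.coeff f 1 \<in> range to_ac"
      using f by (auto simp: monic_rational_def rational_poly_def frob_fixed_iff)
    ultimately obtain p s where "f = [:to_ac p, to_ac s, 1:]" by (metis rangeE)
    thus "f \<in> ?P ` UNIV"
      by (intro image_eqI[of _ _ "(p, - s)"]) auto
  next
    fix f :: "'a alg_closure poly" assume "f \<in> ?P ` UNIV"
    then obtain p s :: 'a where f: "f = [:to_ac p, - to_ac s, 1:]" by auto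
    have "Polynomial.coeff f i ^ CARD('a) = Polynomial.coeff f i" for i
      using to_ac_frob[of "-s"] unfolding f by (auto simp: coeff_pCons split: nat.splits)
    thus "f \<in> monic_rational 2"
      by (auto simp: monic_rational_def rational_poly_def f)
  qed
  moreover have "inj ?P"
    by (auto simp: inj_def)
  ultimately have "L_coeff a 2 = (\<Sum>ps\<in>UNIV. poly_char a (?P ps))"
    using sum.reindex[of ?P UNIV "poly_char a"] by (simp only: L_coeff_def o_def)
  also have "\<dots> = (\<Sum>p\<in>UNIV. \<Sum>s\<in>UNIV. poly_char a [:to_ac p, - to_ac s, 1:])"
    unfolding UNIV_Times_UNIV[symmetric] by (simp add: sum.cartesian_product case_prod_unfold)
  also have "\<dots> = (\<Sum>p\<in>UNIV. \<Sum>s\<in>UNIV. if p = 0 then 0 else \<psi> ((1 + a / p) * s))"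
  proof (intro sum.cong refl)
    fix p s :: 'a
    have "log_deriv_0 (reflect_poly [:to_ac p, - to_ac s, 1:]) = - to_ac s"
      by (simp add: log_deriv_0_def coeff_reflect_poly)
    moreover have "log_deriv_0 [:to_ac p, - to_ac s, 1:] = - to_ac s / to_ac p"
      by (simp add: log_deriv_0_def)
    moreover have "- (- to_ac s) - to_ac a * (- to_ac s / to_ac p) = to_ac ((1 + a / p) * s)"
      by (simp add: algebra_simps)
    ultimately show "poly_char a [:to_ac p, - to_ac s, 1:] = (if p = 0 then 0 else \<psi> ((1 + a / p) * s))"
      unfolding poly_char_def by (simp only: of_ac_to_ac) simp
  qed
  also have "\<dots> = (\<Sum>p\<in>UNIV. if p = - a then of_nat CARD('a) else 0)"
  proof (intro sum.cong refl)
    fix p :: 'a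
    have "1 + a / p = 0 \<longleftrightarrow> p = - a" if "p \<noteq> 0"
      using that by (auto simp: field_simps add_eq_0_iff)
    thus "(\<Sum>s\<in>UNIV. if p = 0 then 0 else \<psi> ((1 + a / p) * s)) = (if p = - a then of_nat CARD('a) else 0)"
      using assms by (cases "p = 0") (simp_all add: sum_mult_UNIV)
  qed
  also have "\<dots> = of_nat CARD('a)" by simp
  finally show ?thesis .
qed

text \<open>Adding \<open>-s\<close> to the coefficient of \<open>X^(n-1)\<close> shifts the sum of
  the roots by \<open>s\<close>. For \<open>n \<ge> 3\<close> this touches neither coefficient 0 nor
  coefficient 1, so the sum of reciprocals stays, and the whole sum is multiplied by
  \<open>\<psi> s \<noteq> 1\<close>.\<close>

lemma L_coeff_ge_3:
  assumes "n \<ge> 3"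
  shows "L_coeff a n = 0"
proof -
  obtain s where s: "\<psi> s \<noteq> 1" using nontrivial by blast
  let ?m = "Polynomial.monom (to_ac (- s)) (n - 1)"
  have shift: "f + Polynomial.monom (to_ac c) (n - 1) \<in> monic_rational n"
    if "f \<in> monic_rational n" for f :: "'a alg_closure poly" and c
  proof -
    have deg: "degree (f + Polynomial.monom (to_ac c) (n - 1)) = n"
      using that assms
      by (subst degree_add_eq_left) (auto simp: monic_rational_def intro: le_less_trans[OF degree_monom_le])
    have "(Polynomial.coeff f i + to_ac c) ^ CARD('a) = Polynomial.coeff f i + to_ac c" for i
      using that frob_add[of "Polynomial.coeff f i" "to_ac c" 1]
      by (simp add: monic_rational_def rational_poly_def)
    hence "rational_poly (f + Polynomial.monom (to_ac c) (n - 1))"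
      using that by (simp add: rational_poly_def monic_rational_def)
    moreover have "Polynomial.coeff (f + Polynomial.monom (to_ac c) (n - 1)) n = 1"
      using that assms by (auto simp: monic_rational_def)
    ultimately show ?thesis
      unfolding monic_rational_def mem_Collect_eq deg by blast
  qed
  have "poly_char a (f + ?m) = poly_char a f * \<psi> s" if f: "f \<in> monic_rational n" for f
  proof (cases "Polynomial.coeff f 0 = 0")
    case True
    thus ?thesis using assms by (simp add: poly_char_def)
  next
    case False
    have c: "Polynomial.coeff (f + ?m) 0 = Polynomial.coeff f 0" "Polynomial.coeff (f + ?m) 1 = Polynomial.coeff f 1"
      using assms by simp_all
    have f': "f + ?m \<in> monic_rational n" using shift[OF that] .
    have r: "Polynomial.coeff (reflect_poly g) 0 = 1" "Polynomial.coeff (reflect_poly g) 1 = Polynomial.coeff g (n - 1)"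
      if "g \<in> monic_rational n" for g :: "'a alg_closure poly"
      using that assms by (auto simp: monic_rational_def coeff_reflect_poly)
    have "log_deriv_0 (reflect_poly (f + ?m)) = log_deriv_0 (reflect_poly f) + to_ac (- s)"
      unfolding log_deriv_0_def r[OF f'] r[OF that] by simp
    moreover have "log_deriv_0 (f + ?m) = log_deriv_0 f"
      unfolding log_deriv_0_def c ..
    moreover obtain u v where "log_deriv_0 f = to_ac u" "log_deriv_0 (reflect_poly f) = to_ac v"
      using log_deriv_0_rational[of f] f by (auto simp: monic_rational_def)
    moreover have "- (to_ac v + to_ac (-s)) - to_ac a * to_ac u = to_ac ((- v - a * u) + s)"
      "- to_ac v - to_ac a * to_ac u = to_ac (- v - a * u)"
      by simp_all
    ultimately have "- log_deriv_0 (reflect_poly (f + ?m)) - to_ac a * log_deriv_0 (f + ?m) = to_ac ((- v - a * u) + s)"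
      "- log_deriv_0 (reflect_poly f) - to_ac a * log_deriv_0 f = to_ac (- v - a * u)"
      by (simp_all only:)
    thus ?thesis
      unfolding poly_char_def c using False by (simp only: of_ac_to_ac add if_False)
  qed
  hence "L_coeff a n * \<psi> s = (\<Sum>f\<in>monic_rational n. poly_char a (f + ?m))"
    by (simp add: L_coeff_def sum_distrib_right)
  also have "\<dots> = L_coeff a n"
    unfolding L_coeff_def
  proof (rule sum.reindex_bij_witness[of _ "\<lambda>f. f - ?m" "\<lambda>f. f + ?m"])
    fix f :: "'a alg_closure poly" assume "f \<in> monic_rational n"
    thus "f + ?m \<in> monic_rational n" by (rule shift)
    have "f - ?m = f + Polynomial.monom (to_ac s) (n - 1)"
      by (simp add: minus_monom)
    thus "f - ?m \<in> monic_rational n"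
      using shift[OF \<open>f \<in> monic_rational n\<close>] by (simp only:)
  qed auto
  finally show ?thesis using s by simp
qed

text \<open>Only the coefficients 0, 1, 2 of the L-function survive, so for \<open>n \<ge> 3\<close>
  Newton's identity is the two-term recurrence with characteristic roots \<open>\<alpha>\<close> and
  \<open>\<beta>\<close>. At \<open>n = 2\<close> its left side is
  \<open>2 * (\<alpha> * \<beta>)\<close> and not 0, hence the separate base case.\<close>

lemma kloosterman_ext_eq_power_sum:
  assumes "a \<noteq> 0" "n > 0"
    and "\<alpha> + \<beta> = - kloosterman a" "\<alpha> * \<beta> = of_nat CARD('a)"
  shows "kloosterman_ext a n = - (\<alpha> ^ n + \<beta> ^ n)"
  using assms(2)
proof (induction n rule: less_induct)
  case (less n)
  let ?S = "kloosterman_ext a" and ?L = "L_coeff a"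
  have K: "kloosterman a = - (\<alpha> + \<beta>)" using assms(3) by (simp add: equation_minus_iff)
  have L: "?L 0 = 1" "?L (Suc 0) = - (\<alpha> + \<beta>)" "?L 2 = \<alpha> * \<beta>" "\<And>n. n \<ge> 3 \<Longrightarrow> ?L n = 0"
    using L_coeff_0 L_coeff_1 L_coeff_2[OF assms(1)] L_coeff_ge_3 assms(4) K by auto
  have S1: "?S 1 = - (\<alpha> + \<beta>)"
    using L_coeff_newton[of 1 a] L by simp
  consider "n = 1" | "n = 2" | "n \<ge> 3" using less.prems by linarith
  thus ?case
  proof cases
    case 1
    thus ?thesis using S1 by simp
  next
    case 2
    have "2 * (\<alpha> * \<beta>) = ?S 1 * ?L 1 + ?S 2 * ?L 0"
      using L_coeff_newton[of 2 a] L by (simp add: numeral_2_eq_2)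
    hence "2 * (\<alpha> * \<beta>) = (- (\<alpha> + \<beta>)) * (- (\<alpha> + \<beta>)) + ?S 2"
      using S1 L by simp
    hence "2 * (\<alpha> * \<beta>) = (\<alpha> + \<beta>) * (\<alpha> + \<beta>) + ?S 2"
      unfolding minus_mult_minus .
    hence "?S 2 = 2 * (\<alpha> * \<beta>) - (\<alpha> + \<beta>) * (\<alpha> + \<beta>)"
      by (metis add_diff_cancel_left')
    thus ?thesis
      using 2 by (simp add: power2_eq_square algebra_simps)
  next
    case 3
    have "of_nat n * ?L n = (\<Sum>k=1..n. ?S k * ?L (n - k))" by (rule L_coeff_newton)
    also have "\<dots> = (\<Sum>k\<in>{n-2,n-1,n}. ?S k * ?L (n - k))"
      using 3 by (intro sum.mono_neutral_right) (auto simp: L(4))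
    also have "\<dots> = ?S (n-2) * (\<alpha> * \<beta>) + ?S (n-1) * (- (\<alpha> + \<beta>)) + ?S n"
    proof -
      have "n - 2 \<noteq> n - 1" "n - 2 \<noteq> n" "n - 1 \<noteq> n" "n - (n - 2) = 2" "n - (n - 1) = Suc 0"
        using 3 by auto
      thus ?thesis using L(1-3) by (simp del: diff_diff_cancel)
    qed
    finally have "?S (n-2) * (\<alpha> * \<beta>) + ?S (n-1) * (- (\<alpha> + \<beta>)) + ?S n = 0"
      unfolding L(4)[OF 3] by simp
    hence "?S n = - (?S (n-2) * (\<alpha> * \<beta>) + ?S (n-1) * (- (\<alpha> + \<beta>)))"
      by (simp only: add_eq_0_iff)
    also have "\<dots> = - (?S (n-2) * (\<alpha> * \<beta>)) + ?S (n-1) * (\<alpha> + \<beta>)"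
      unfolding mult_minus_right by simp
    also have "?S (n-2) = - (\<alpha> ^ (n-2) + \<beta> ^ (n-2))" using less.IH[of "n-2"] 3 by simp
    also have "?S (n-1) = - (\<alpha> ^ (n-1) + \<beta> ^ (n-1))" using less.IH[of "n-1"] 3 by simp
    also have "- (- (\<alpha> ^ (n-2) + \<beta> ^ (n-2)) * (\<alpha> * \<beta>)) + - (\<alpha> ^ (n-1) + \<beta> ^ (n-1)) * (\<alpha> + \<beta>)
        = - (\<alpha> ^ n + \<beta> ^ n)"
    proof -
      define m where "m = n - 2"
      have m: "n - 2 = m" "n - 1 = Suc m" "n = Suc (Suc m)" using 3 by (simp_all add: m_def)
      show ?thesis unfolding m(1,2) by (simp add: m(3) algebra_simps)
    qed
    finally show ?thesis .
  qed
qed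

end

section \<open>Stepanov's method and the Weil bound\<close>

text \<open>The term of largest degree among those with nonzero coefficient is unique, so nothing
  cancels its leading coefficient. This is the independence that keeps Stepanov's auxiliary
  polynomial from vanishing.\<close>

lemma sum_smult_neq_0_if_degrees_distinct:
  fixes p :: "'t \<Rightarrow> 'b::idom poly"
  assumes "finite T" "inj_on (\<lambda>t. degree (p t)) T" "\<And>t. t \<in> T \<Longrightarrow> p t \<noteq> 0"
    and "t1 \<in> T" "c t1 \<noteq> 0"
  shows "(\<Sum>t\<in>T. Polynomial.smult (c t) (p t)) \<noteq> 0"
proof -
  define T' where "T' = {t \<in> T. c t \<noteq> 0}"
  have T': "finite T'" "T' \<noteq> {}" using assms by (auto simp: T'_def)
  define N where "N = Max ((\<lambda>t. degree (p t)) ` T')"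
  have "N \<in> (\<lambda>t. degree (p t)) ` T'" unfolding N_def by (rule Max_in) (use T' in auto)
  then obtain t0 where t0: "t0 \<in> T'" "N = degree (p t0)" by auto
  have "Polynomial.coeff (\<Sum>t\<in>T. Polynomial.smult (c t) (p t)) N = (\<Sum>t\<in>T. c t * Polynomial.coeff (p t) N)"
    by (simp add: coeff_sum)
  also have "\<dots> = (\<Sum>t\<in>{t0}. c t * Polynomial.coeff (p t) N)"
  proof (rule sum.mono_neutral_right)
    show "\<forall>t\<in>T - {t0}. c t * Polynomial.coeff (p t) N = 0"
    proof
      fix t assume t: "t \<in> T - {t0}"
      show "c t * Polynomial.coeff (p t) N = 0"
      proof (cases "c t = 0")
        case False
        hence "t \<in> T'" using t by (auto simp: T'_def)
        hence "degree (p t) \<le> N" unfolding N_def using T' by (intro Max_ge) auto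
        moreover have "degree (p t) \<noteq> N"
          using t t0 assms(2) by (auto simp: inj_on_def T'_def)
        ultimately show ?thesis by (simp add: coeff_eq_0)
      qed simp
    qed
  qed (use assms t0 in \<open>auto simp: T'_def\<close>)
  also have "\<dots> \<noteq> 0"
    using t0 assms(3)[of t0] by (auto simp: T'_def)
  finally show ?thesis by auto
qed

lemma rational_poly_sum:
  assumes "\<And>i. i \<in> A \<Longrightarrow> rational_poly (f i :: 'a::{field,finite} alg_closure poly)"
  shows "rational_poly (\<Sum>i\<in>A. f i)"
  using assms by (simp add: rational_poly_def coeff_sum frob_sum[where k=1, simplified])

lemma rational_poly_monom: "rational_poly (Polynomial.monom (to_ac c) n)"
  by (simp add: rational_poly_def)

lemma rational_poly_add:
  "rational_poly f \<Longrightarrow> rational_poly g \<Longrightarrow> rational_poly (f + g :: 'a::{field,finite} alg_closure poly)"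
  using frob_add[where k=1, where ?'a='a] by (simp add: rational_poly_def)

lemma rational_poly_power:
  "rational_poly f \<Longrightarrow> rational_poly (f ^ n)"
  by (simp add: rational_poly_iff frob_poly_power)

lemma card_rational_poly_le:
  fixes B :: "'a::{field,finite} alg_closure poly set"
  assumes "\<And>f. f \<in> B \<Longrightarrow> rational_poly f \<and> (\<forall>i\<ge>D. Polynomial.coeff f i = 0)"
  shows "finite B" "card B \<le> CARD('a) ^ D"
proof -
  let ?P = "PiE {..<D} (\<lambda>_. range (to_ac :: 'a \<Rightarrow> _))"
  have inj: "inj_on (\<lambda>f. restrict (Polynomial.coeff f) {..<D}) B"
  proof (rule inj_onI)
    fix f g assume fg: "f \<in> B" "g \<in> B"
      "restrict (Polynomial.coeff f) {..<D} = restrict (Polynomial.coeff g) {..<D}"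
    show "f = g"
    proof (rule poly_eqI)
      fix i
      show "Polynomial.coeff f i = Polynomial.coeff g i"
      proof (cases "i < D")
        case True
        thus ?thesis using fun_cong[OF fg(3), of i] by simp
      next
        case False
        thus ?thesis using assms[OF fg(1)] assms[OF fg(2)] by simp
      qed
    qed
  qed
  have sub: "(\<lambda>f. restrict (Polynomial.coeff f) {..<D}) ` B \<subseteq> ?P"
    using assms by (intro image_subsetI restrict_PiE_iff[THEN iffD2]) (auto simp: rational_poly_def frob_fixed_iff)
  have fin: "finite ?P" by (intro finite_PiE) auto
  have "card ?P = CARD('a) ^ D"
    by (simp add: card_PiE card_image inj_to_ac)
  thus "card B \<le> CARD('a) ^ D"
    using card_inj_on_le[OF inj sub fin] by simp
  show "finite B"
    using finite_imageD[OF finite_subset[OF sub fin] inj] .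
qed

lemma frob_trace_add:
  "frob_trace (m + n) z = frob_trace m z + frob_trace n (z ^ (CARD('a) ^ m) :: 'a::{field,finite} alg_closure)"
  unfolding frob_trace_def by (induction n) (simp_all add: frob_compose add.assoc)

text \<open>Stepanov's method. With \<open>w = Tr_m (x + a/x)\<close> one has \<open>w(x ^ (q^m)) = u - w(x)\<close> on the point set,
  hence a relation between the functions \<open>x^i * w^j * x^(k * q^m)\<close>, evaluated at \<open>x ^ (q^m)\<close>,
  becomes an equation of much smaller degree for the points.\<close>
lemma card_frob_trace_eq_le:
  fixes a u :: "'a::{field,finite}"
  assumes m: "m > 0"
  shows "card {x. x ^ (CARD('a) ^ (2 * m)) = x \<and> x \<noteq> 0 \<and> frob_trace (2 * m) (x + to_ac a / x) = to_ac u}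
           \<le> CARD('a) ^ (2 * m - 1) + 3 * CARD('a) ^ m" (is "card ?X \<le> _")
proof -
  define q where "q = CARD('a)"
  \<comment> \<open>\<open>R\<close> bounds the order of the pole of \<open>w\<close> at 0:
    multiplying by \<open>x^R\<close> clears the denominators \<open>x^(q^i)\<close> for
    \<open>i < m\<close> and gives the polynomial \<open>W\<close>, of degree
    \<open>2 * R\<close>.\<close>
  define R where "R = q ^ (m - 1)"
  have q: "q > 1" using card_field_gt_1[where ?'a='a] by (simp add: q_def)
  have R: "R > 0" using q by (simp add: R_def)
  have qm: "q ^ m = q * R" using m by (cases m) (simp_all add: R_def)
  have q2m: "q ^ (2 * m - 1) = q * R * R"
  proof -
    have "2 * m - 1 = Suc ((m - 1) + (m - 1))" using m by simp
    hence "q ^ (2 * m - 1) = q ^ Suc ((m - 1) + (m - 1))" by (rule arg_cong)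
    thus ?thesis unfolding R_def power_add power_Suc by (simp only: mult.assoc)
  qed
  define w where "w = (\<lambda>x :: 'a alg_closure. frob_trace m (x + to_ac a / x))"
  define W where "W = (\<Sum>i<m. Polynomial.monom (to_ac 1) (R + q ^ i) + Polynomial.monom (to_ac a) (R - q ^ i))"
  have qi: "q ^ i \<le> R" if "i < m" for i
    unfolding R_def by (rule power_increasing) (use that q in auto)
  have polyW: "poly W x = x ^ R * w x" if "x \<noteq> 0" for x
  proof -
    have "poly W x = (\<Sum>i<m. x ^ R * (x ^ (q ^ i) + to_ac a / x ^ (q ^ i)))"
      unfolding W_def poly_sum
    proof (intro sum.cong refl)
      fix i assume "i \<in> {..<m}"
      hence "x ^ (R - q ^ i) = x ^ R / x ^ (q ^ i)"
        using qi[of i] that by (intro power_diff) auto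
      thus "poly (Polynomial.monom (to_ac 1) (R + q ^ i) + Polynomial.monom (to_ac a) (R - q ^ i)) x =
          x ^ R * (x ^ (q ^ i) + to_ac a / x ^ (q ^ i))"
        by (simp add: poly_monom power_add distrib_left)
    qed
    also have "\<dots> = x ^ R * w x"
      by (simp add: w_def frob_trace_def frob_add power_divide q_def sum_distrib_left)
    finally show ?thesis .
  qed
  have degW: "degree W \<le> 2 * R"
    unfolding W_def
  proof (rule degree_sum_le)
    fix i assume "i \<in> {..<m}"
    hence "R + q ^ i \<le> 2 * R" "R - q ^ i \<le> 2 * R" using qi[of i] by simp_all
    thus "degree (Polynomial.monom (to_ac 1) (R + q ^ i) + Polynomial.monom (to_ac a) (R - q ^ i)) \<le> 2 * R"
      by (meson degree_add_le degree_monom_le order_trans)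
  qed simp
  have ratW: "rational_poly W"
    unfolding W_def by (intro rational_poly_sum rational_poly_add rational_poly_monom)
  have coeffW: "Polynomial.coeff W (2 * R) = 1"
  proof -
    have "Polynomial.coeff W (2 * R) = (\<Sum>i<m. if i = m - 1 then 1 else 0)"
      unfolding W_def coeff_sum
    proof (intro sum.cong refl)
      fix i assume i: "i \<in> {..<m}"
      have "R + q ^ i = 2 * R \<longleftrightarrow> q ^ i = q ^ (m - 1)" by (auto simp: R_def)
      also have "\<dots> \<longleftrightarrow> i = m - 1" using q by (rule power_inject_exp)
      finally have "R + q ^ i = 2 * R \<longleftrightarrow> i = m - 1" .
      moreover have "R - q ^ i \<noteq> 2 * R" using R by simp
      ultimately show "Polynomial.coeff (Polynomial.monom (to_ac 1) (R + q ^ i) +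
          Polynomial.monom (to_ac a) (R - q ^ i)) (2 * R) = (if i = m - 1 then 1 else 0)"
        by simp
    qed
    thus ?thesis using m by simp
  qed
  \<comment> \<open>This is \<open>x^R * (u - w x)\<close>, which on the point set equals
    \<open>x^R * w (x^(q^m))\<close>.\<close>
  define V where "V = Polynomial.monom (to_ac u) R - W"
  have coeffV: "Polynomial.coeff V (2 * R) = - 1"
    using R by (simp add: V_def coeffW)
  hence V0: "V \<noteq> 0" by auto
  have degV: "degree V = 2 * R"
  proof (rule antisym)
    show "degree V \<le> 2 * R"
      unfolding V_def by (intro degree_diff_le degW order.trans[OF degree_monom_le]) simp
    show "2 * R \<le> degree V" by (rule le_degree) (simp add: coeffV)
  qed

  \<comment> \<open>Two demands fix this box. With \<open>j < q\<close> and \<open>k < R\<close>,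
    the number \<open>(i * q + j) * R + k\<close> is a mixed-radix numeral, so the degrees of the
    \<open>hZ\<close> are distinct. With \<open>R + 2\<close> values of \<open>i\<close>,
    \<open>card T - D = (q + 1) * R - 2\<close>, which is positive even for \<open>q = 2\<close> and
    \<open>R = 1\<close>.\<close>
  define T where "T = {..<R + 2} \<times> {..<q} \<times> {..<R}"
  have T: "finite T" "card T = (R + 2) * (q * R)"
    by (simp_all add: T_def card_cartesian_product)
  \<comment> \<open>The exponent \<open>(q - 1 - j) * R\<close> completes the powers of
    \<open>x^R\<close> inside \<open>W^j\<close> and \<open>V^j\<close>, so that all terms share the
    factor \<open>x^((q - 1) * R)\<close>, which can be divided out.\<close>
  define hH where "hH = (\<lambda>(i, j, k). Polynomial.monom 1 (i + k * (q * R) + (q - 1 - j) * R) * W ^ j)"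
  define hZ where "hZ = (\<lambda>(i, j, k). Polynomial.monom 1 (i * (q * R) + k + (q - 1 - j) * R) * V ^ j)"
  define H where "H = (\<lambda>c :: nat \<times> nat \<times> nat \<Rightarrow> 'a. \<Sum>t\<in>T. Polynomial.smult (to_ac (c t)) (hH t))"
  define D where "D = (R + 1) + (R - 1) * (q * R) + 2 * (q - 1) * R + 1"

  have degH: "degree (hH t) < D" if "t \<in> T" for t
  proof -
    obtain i j k where t: "t = (i, j, k)" by (cases t)
    have ijk: "i \<le> R + 1" "j \<le> q - 1" "k \<le> R - 1" using that by (auto simp: T_def t)
    have "degree (hH t) \<le> i + k * (q * R) + (q - 1 - j) * R + j * (2 * R)"
      unfolding hH_def t prod.case
      by (intro order.trans[OF degree_mult_le] add_mono degree_monom_le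
           order.trans[OF degree_power_le] ) (use degW in \<open>simp add: mult.commute\<close>)
    also have "\<dots> = i + k * (q * R) + ((q - 1 - j) + 2 * j) * R" by (simp add: algebra_simps)
    also have "\<dots> \<le> (R + 1) + (R - 1) * (q * R) + (2 * (q - 1)) * R"
      using ijk by (intro add_mono mult_right_mono) auto
    finally show ?thesis by (simp add: D_def)
  qed
  \<comment> \<open>Pigeonhole in place of linear algebra: the coefficient vectors over the base
    field outnumber the base-field polynomials of degree below \<open>D\<close>, so two of them give
    the same \<open>H\<close>, and their difference is a nontrivial relation
    \<open>c\<close>.\<close>
  have "card (H ` PiE T (\<lambda>_. UNIV)) \<le> q ^ D"
    unfolding q_def
  proof (rule card_rational_poly_le(2))
    fix f assume "f \<in> H ` PiE T (\<lambda>_. UNIV)"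
    then obtain c where f: "f = H c" by auto
    have "rational_poly f"
      unfolding f H_def
    proof (rule rational_poly_sum)
      fix t assume "t \<in> T"
      have "rational_poly (Polynomial.monom (to_ac (c t)) 0 * hH t)"
        unfolding hH_def using rational_poly_monom[of 1]
        by (auto intro!: rational_poly_mult rational_poly_power ratW rational_poly_monom split: prod.splits)
      thus "rational_poly (Polynomial.smult (to_ac (c t)) (hH t))"
        by (simp add: monom_0)
    qed
    moreover have "Polynomial.coeff f i = 0" if "i \<ge> D" for i
    proof -
      have "Polynomial.coeff (hH t) i = 0" if "t \<in> T" for t
        using degH[OF that] \<open>i \<ge> D\<close> by (intro coeff_eq_0) simp
      thus ?thesis unfolding f H_def coeff_sum by (intro sum.neutral) simp
    qed
    ultimately show "rational_poly f \<and> (\<forall>i\<ge>D. Polynomial.coeff f i = 0)" by blast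
  qed
  also have "q ^ D < q ^ card T"
  proof (rule power_strict_increasing)
    obtain R' where R': "R = Suc R'" using R by (cases R) auto
    obtain q' where q': "q = Suc (Suc q')" using q by (metis less_imp_Suc_add plus_1_eq_Suc add_Suc)
    show "D < card T" unfolding T(2) D_def R' q' by (simp add: algebra_simps)
  qed (use q in simp)
  also have "q ^ card T = card (PiE T (\<lambda>_. UNIV :: 'a set))"
    using T by (simp add: card_PiE q_def)
  finally have "\<not> inj_on H (PiE T (\<lambda>_. UNIV))"
    by (rule pigeonhole)
  then obtain c1 c2 where c12: "c1 \<in> PiE T (\<lambda>_. UNIV)" "c2 \<in> PiE T (\<lambda>_. UNIV)" "H c1 = H c2" "c1 \<noteq> c2"
    by (auto simp: inj_on_def)
  define c where "c = (\<lambda>t. c1 t - c2 t)"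
  obtain t1 where t1: "t1 \<in> T" "c t1 \<noteq> 0"
  proof -
    have "\<exists>t\<in>T. c1 t \<noteq> c2 t"
      using c12 PiE_ext[of c1 T "\<lambda>_. UNIV" c2] by blast
    thus ?thesis using that by (auto simp: c_def)
  qed
  have Hc: "H c = 0"
  proof -
    have "H c = H c1 - H c2"
      by (simp add: H_def c_def smult_diff_left sum_subtractf)
    thus ?thesis using c12 by simp
  qed

  \<comment> \<open>Substituting \<open>x^(q^m)\<close> into \<open>H c\<close> would multiply all
    degrees by \<open>q^m\<close>. On the point set \<open>x^(k * q^(2 * m))\<close> collapses to
    \<open>x^k\<close> and \<open>w (x^(q^m))\<close> to \<open>u - w x\<close>, which keeps the
    degree of \<open>Z\<close> near \<open>q^(2 * m - 1)\<close>.\<close>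
  define Z where "Z = (\<Sum>t\<in>T. Polynomial.smult (to_ac (c t)) (hZ t))"
  have degZ: "degree (hZ (i, j, k)) = (i * q + j) * R + k + (q - 1) * R" if "j < q" for i j k
  proof -
    have "degree (hZ (i, j, k)) = i * (q * R) + k + (q - 1 - j) * R + j * (2 * R)"
      unfolding hZ_def using V0
      by (simp add: degree_mult_eq degree_monom_eq degree_power_eq degV)
    also have "\<dots> = (i * q + j) * R + k + ((q - 1 - j) + j) * R" by (simp add: algebra_simps)
    finally show ?thesis using that by simp
  qed
  have "Z \<noteq> 0"
    unfolding Z_def
  proof (rule sum_smult_neq_0_if_degrees_distinct)
    show "inj_on (\<lambda>t. degree (hZ t)) T"
    proof (rule inj_onI)
      fix s t assume st: "s \<in> T" "t \<in> T" "degree (hZ s) = degree (hZ t)"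
      obtain i j k where s: "s = (i, j, k)" by (cases s)
      obtain i' j' k' where t: "t = (i', j', k')" by (cases t)
      have lt: "j < q" "j' < q" "k < R" "k' < R" using st by (auto simp: T_def s t)
      have eq: "(i * q + j) * R + k = (i' * q + j') * R + k'"
        using st(3) lt by (simp add: s t degZ)
      have "k = k'" using arg_cong[OF eq, of "\<lambda>n. n mod R"] lt by simp
      moreover from this have eq': "i * q + j = i' * q + j'" using eq R by simp
      have "j = j'" using arg_cong[OF eq', of "\<lambda>n. n mod q"] lt by simp
      moreover from this have "i = i'" using eq' q by simp
      ultimately show "s = t" by (simp add: s t)
    qed
    show "hZ t \<noteq> 0" for t
      using V0 by (cases t) (simp add: hZ_def)
    show "to_ac (c t1) \<noteq> 0" using t1 by simp
  qed (use T t1 in auto)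
  have "degree Z \<le> (R + 1) * (q * R) + (R - 1) + 2 * (q - 1) * R"
    unfolding Z_def
  proof (rule degree_sum_le)
    fix t assume "t \<in> T"
    obtain i j k where t: "t = (i, j, k)" by (cases t)
    have ijk: "i \<le> R + 1" "j \<le> q - 1" "j < q" "k \<le> R - 1" using \<open>t \<in> T\<close> by (auto simp: T_def t)
    have "degree (Polynomial.smult (to_ac (c t)) (hZ t)) \<le> degree (hZ t)" by (rule degree_smult_le)
    also have "\<dots> = i * (q * R) + k + (j + (q - 1)) * R" unfolding t degZ[OF ijk(3)] add_mult_distrib by (simp only: add_ac mult.assoc)
    also have "\<dots> \<le> (R + 1) * (q * R) + (R - 1) + (2 * (q - 1)) * R"
      using ijk by (intro add_mono mult_right_mono) auto
    finally show "degree (Polynomial.smult (to_ac (c t)) (hZ t)) \<le> (R + 1) * (q * R) + (R - 1) + 2 * (q - 1) * R" .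
  qed (rule T)
  also have "\<dots> \<le> q * R * R + 3 * (q * R)"
  proof -
    obtain R' where R': "R = Suc R'" using R by (cases R) auto
    obtain q' where q': "q = Suc q'" using q by (cases q) auto
    show ?thesis unfolding R' q' by (simp add: algebra_simps)
  qed
  finally have degZ_le: "degree Z \<le> q ^ (2 * m - 1) + 3 * q ^ m"
    unfolding q2m qm .

  have "poly Z x = 0" if "x \<in> ?X" for x
  proof -
    have x: "x ^ (q ^ (2 * m)) = x" "x \<noteq> 0" "frob_trace (2 * m) (x + to_ac a / x) = to_ac u"
      using that by (auto simp: q_def)
    define y where "y = x ^ (q ^ m)"
    have y0: "y \<noteq> 0" using x by (simp add: y_def)
    have yx: "y ^ (q * R) = x"
      using x(1) by (simp add: y_def frob_compose qm[symmetric] mult_2)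
    have xy: "x ^ (q * R) = y" by (simp add: y_def qm)
    have "(x + to_ac a / x) ^ (q ^ m) = y + to_ac a / y"
      by (simp add: y_def q_def frob_add power_divide)
    hence "frob_trace (2 * m) (x + to_ac a / x) = w x + w y"
      unfolding w_def mult_2 by (simp add: frob_trace_add q_def)
    hence wy: "w y = to_ac u - w x"
      using x(3) by (simp add: eq_diff_eq add.commute)
    have "poly (hH t) y = y ^ ((q - 1) * R) * (y ^ fst t * w y ^ fst (snd t) * x ^ snd (snd t))"
      if "t \<in> T" for t
    proof -
      obtain i j k where t: "t = (i, j, k)" by (cases t)
      have "j < q" using that by (simp add: T_def t)
      hence qj: "(q - 1) * R = (q - 1 - j) * R + j * R" by (simp add: add_mult_distrib[symmetric])
      have "y ^ (k * (q * R)) = x ^ k"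
        by (metis yx power_mult mult.commute)
      moreover have "(y ^ R * w y) ^ j = y ^ (j * R) * w y ^ j"
        by (metis power_mult_distrib power_mult mult.commute)
      ultimately show ?thesis
        unfolding t hH_def prod.case qj poly_mult poly_power poly_monom polyW[OF y0] power_add fst_conv snd_conv
        by (simp only: mult_ac mult_1)
    qed
    hence "poly (H c) y = y ^ ((q - 1) * R) * (\<Sum>t\<in>T. to_ac (c t) * (y ^ fst t * w y ^ fst (snd t) * x ^ snd (snd t)))"
      by (simp add: H_def poly_sum sum_distrib_left mult_ac)
    hence S0: "(\<Sum>t\<in>T. to_ac (c t) * (y ^ fst t * w y ^ fst (snd t) * x ^ snd (snd t))) = 0"
      using y0 by (simp add: Hc)
    have "poly (hZ t) x = x ^ ((q - 1) * R) * (y ^ fst t * w y ^ fst (snd t) * x ^ snd (snd t))"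
      if "t \<in> T" for t
    proof -
      obtain i j k where t: "t = (i, j, k)" by (cases t)
      have "j < q" using that by (simp add: T_def t)
      hence qj: "(q - 1) * R = (q - 1 - j) * R + j * R" by (simp add: add_mult_distrib[symmetric])
      have "x ^ (i * (q * R)) = y ^ i"
        by (metis xy power_mult mult.commute)
      moreover have "poly V x = x ^ R * w y"
        using x(2) by (simp add: V_def poly_monom polyW wy algebra_simps)
      moreover have "(x ^ R * w y) ^ j = x ^ (j * R) * w y ^ j"
        by (metis power_mult_distrib power_mult mult.commute)
      ultimately show ?thesis
        unfolding t hZ_def prod.case qj poly_mult poly_power poly_monom power_add fst_conv snd_conv
        by (simp only: mult_ac mult_1)
    qed
    hence "poly Z x = x ^ ((q - 1) * R) * (\<Sum>t\<in>T. to_ac (c t) * (y ^ fst t * w y ^ fst (snd t) * x ^ snd (snd t)))"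
      by (simp add: Z_def poly_sum sum_distrib_left mult_ac)
    thus ?thesis by (simp add: S0)
  qed
  hence "card ?X \<le> card {x. poly Z x = 0}"
    by (intro card_mono poly_roots_finite \<open>Z \<noteq> 0\<close>) auto
  also have "\<dots> \<le> degree Z" by (rule card_poly_roots_bound[OF \<open>Z \<noteq> 0\<close>])
  also note degZ_le
  finally show ?thesis by (simp add: q_def)
qed

text \<open>The numbers are the roots of \<open>T^2 + \<kappa> T + Q\<close>. If
  \<open>\<kappa>^2 \<le> 4 Q\<close> they are conjugate of modulus \<open>sqrt Q\<close>. Otherwise
  they are real and their squares add up to \<open>\<kappa>^2 - 2 Q > 2 Q\<close>, so one square
  exceeds \<open>Q\<close>; the even exponent makes both contributions nonnegative.\<close>

lemma quadratic_power_sum_bounds: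
  fixes \<kappa> Q :: real
  assumes "Q > 0"
  obtains \<alpha> \<beta> :: complex where
    "\<alpha> + \<beta> = - of_real \<kappa>" "\<alpha> * \<beta> = of_real Q"
    "\<And>m. Re (\<alpha> ^ (2 * m) + \<beta> ^ (2 * m)) \<ge> - 2 * Q ^ m"
    "\<kappa>\<^sup>2 > 4 * Q \<Longrightarrow> \<exists>r>Q. \<forall>m. Re (\<alpha> ^ (2 * m) + \<beta> ^ (2 * m)) \<ge> r ^ m"
proof (cases "\<kappa>\<^sup>2 \<le> 4 * Q")
  case True
  define \<alpha> where "\<alpha> = Complex (- \<kappa> / 2) (sqrt (4 * Q - \<kappa>\<^sup>2) / 2)"
  have norm2: "(cmod \<alpha>)\<^sup>2 = Q"
    using True assms by (simp add: \<alpha>_def cmod_def power_divide field_simps)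
  show ?thesis
  proof (rule that[of \<alpha> "cnj \<alpha>"])
    show "\<alpha> + cnj \<alpha> = - of_real \<kappa>"
      by (simp add: \<alpha>_def complex_eq_iff)
    show "\<alpha> * cnj \<alpha> = of_real Q"
      by (simp add: complex_norm_square[symmetric] norm2)
    show "Re (\<alpha> ^ (2 * m) + cnj \<alpha> ^ (2 * m)) \<ge> - 2 * Q ^ m" for m
    proof -
      have "cmod (\<alpha> ^ (2 * m)) = Q ^ m"
        by (simp add: norm_power power_mult norm2)
      hence "- (Q ^ m) \<le> Re (\<alpha> ^ (2 * m))"
        using abs_Re_le_cmod[of "\<alpha> ^ (2 * m)"] by linarith
      moreover have "Re (cnj \<alpha> ^ (2 * m)) = Re (\<alpha> ^ (2 * m))"
        by (simp only: complex_cnj_power[symmetric] cnj.sel)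
      ultimately show ?thesis by simp
    qed
  qed (use True in simp)
next
  case False
  define s where "s = sqrt (\<kappa>\<^sup>2 - 4 * Q)"
  have s: "s\<^sup>2 = \<kappa>\<^sup>2 - 4 * Q" using False by (simp add: s_def)
  define x where "x = (- \<kappa> + s) / 2"
  define y where "y = (- \<kappa> - s) / 2"
  have xy: "x + y = - \<kappa>" "x * y = Q" "x\<^sup>2 + y\<^sup>2 > 2 * Q"
    using s False by (simp_all add: x_def y_def field_simps power2_eq_square)
  have Re: "Re (of_real x ^ (2 * m) + of_real y ^ (2 * m)) = (x\<^sup>2) ^ m + (y\<^sup>2) ^ m" for m
    by (simp add: power_mult flip: of_real_power)
  show ?thesis
  proof (rule that[of "of_real x" "of_real y"])
    show "complex_of_real x + of_real y = - of_real \<kappa>"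
      by (simp add: xy flip: of_real_add of_real_minus)
    show "complex_of_real x * of_real y = of_real Q"
      by (simp add: xy flip: of_real_mult)
    show "Re (of_real x ^ (2 * m) + of_real y ^ (2 * m)) \<ge> - 2 * Q ^ m" for m
    proof -
      have "0 \<le> (x\<^sup>2) ^ m" "0 \<le> (y\<^sup>2) ^ m" "0 \<le> Q ^ m" using assms by simp_all
      thus ?thesis unfolding Re by linarith
    qed
    have "max (x\<^sup>2) (y\<^sup>2) > Q" using xy(3) by linarith
    moreover have "max (x\<^sup>2) (y\<^sup>2) ^ m \<le> Re (of_real x ^ (2 * m) + of_real y ^ (2 * m))" for m
      unfolding Re by (simp add: max_def)
    ultimately show "\<exists>r>Q. \<forall>m. Re (of_real x ^ (2 * m) + of_real y ^ (2 * m)) \<ge> r ^ m"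
      by blast
  qed
qed

section \<open>Weil's bound from the point counts\<close>

context nontrivial_add_char
begin

lemma kloosterman_real: "kloosterman a \<in> \<real>"
proof -
  have "cnj (kloosterman a) = (\<Sum>x\<in>UNIV - {0}. \<psi> (- x + a / (- x)))"
    by (simp add: kloosterman_def uminus[symmetric])
  also have "\<dots> = kloosterman a"
    unfolding kloosterman_def
    by (rule sum.reindex_bij_witness[of _ uminus uminus]) auto
  finally show ?thesis by (simp add: Reals_cnj_iff)
qed

text \<open>The conjugate sums for all \<open>\<psi> (c * _)\<close> are bounded together: their even power sums count
  points, and being real each of them contributes at least \<open>- 2 * q^m\<close>.\<close>
theorem kloosterman_bound:
  assumes a: "a \<noteq> 0"
  shows "cmod (kloosterman a) \<le> 2 * sqrt (real CARD('a))"
proof -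
  define q where "q = real CARD('a)"
  have q: "q > 1" using card_field_gt_1[where ?'a='a] by (simp add: q_def)
  define K where "K = (\<lambda>c. nontrivial_add_char.kloosterman (\<lambda>x. \<psi> (c * x)) a)"
  define S where "S = (\<lambda>c n. nontrivial_add_char.kloosterman_ext (\<lambda>x. \<psi> (c * x)) a n)"
  define Pts where "Pts m u = {x :: 'a alg_closure. x ^ (CARD('a) ^ (2 * m)) = x \<and> x \<noteq> 0 \<and>
      frob_trace (2 * m) (x + to_ac a / x) = to_ac u}" for m u
  define Y where "Y m = {x :: 'a alg_closure. x ^ (CARD('a) ^ (2 * m)) = x \<and> x \<noteq> 0}" for m
  have tw: "nontrivial_add_char (\<lambda>x. \<psi> (c * x))" if "c \<noteq> 0" for c
    using that by (rule twist)
  have K_real: "K c \<in> \<real>" if "c \<noteq> 0" for c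
    unfolding K_def by (rule nontrivial_add_char.kloosterman_real[OF tw[OF that]])
  have finY: "finite (Y m)" and cardY: "real (card (Y m)) = q ^ (2 * m) - 1" if "m > 0" for m
  proof -
    have Y: "Y m = {x :: 'a alg_closure. x ^ (CARD('a) ^ (2 * m)) = x} - {0}" by (auto simp: Y_def)
    show "finite (Y m)" unfolding Y using card_frob_fixed_le(1)[of "2 * m", where ?'a='a] that by simp
    have "card (Y m) = CARD('a) ^ (2 * m) - 1"
      unfolding Y using card_frob_fixed[of "2 * m", where ?'a='a] that
      by (subst card_Diff_singleton) auto
    thus "real (card (Y m)) = q ^ (2 * m) - 1"
      by (simp add: q_def of_nat_diff)
  qed
  have YX: "Y m = (\<Union>u\<in>UNIV. Pts m u)" for m
  proof -
    have "frob_trace (2 * m) (x + to_ac a / x) \<in> range to_ac" if "x \<in> Y m" for x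
      using that by (intro frob_trace_rational) (auto simp: Y_def frob_add power_divide)
    thus ?thesis by (auto simp: Pts_def Y_def)
  qed
  have disj: "Pts m u \<inter> Pts m v = {}" if "u \<noteq> v" for m u v using that by (auto simp: Pts_def)
  have finX: "finite (Pts m u)" if "m > 0" for m u
    by (rule finite_subset[OF _ finY[OF that]]) (auto simp: Pts_def Y_def)
  have sum_X: "(\<Sum>u\<in>UNIV. real (card (Pts m u))) = q ^ (2 * m) - 1" if "m > 0" for m
  proof -
    have "card (Y m) = (\<Sum>u\<in>UNIV. card (Pts m u))"
      unfolding YX by (rule card_UN_disjoint) (use finX[OF that] disj in auto)
    thus ?thesis using cardY[OF that] by simp
  qed
  have S_eq: "S c (2 * m) = (\<Sum>u\<in>UNIV. of_nat (card (Pts m u)) * \<psi> (c * u))" if "c \<noteq> 0" "m > 0" for c m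
  proof -
    interpret tw: nontrivial_add_char "\<lambda>x. \<psi> (c * x)" by (rule tw[OF that(1)])
    have "S c (2 * m) = (\<Sum>x\<in>Y m. \<psi> (c * of_ac (frob_trace (2 * m) (x + to_ac a / x))))"
      by (simp add: S_def tw.kloosterman_ext_def Y_def)
    also have "\<dots> = (\<Sum>u\<in>UNIV. \<Sum>x\<in>Pts m u. \<psi> (c * of_ac (frob_trace (2 * m) (x + to_ac a / x))))"
      unfolding YX by (rule sum.UNION_disjoint) (use finX[OF that(2)] disj in auto)
    also have "\<dots> = (\<Sum>u\<in>UNIV. \<Sum>x\<in>Pts m u. \<psi> (c * u))"
      by (intro sum.cong refl) (auto simp: Pts_def)
    finally show ?thesis by simp
  qed
  \<comment> \<open>Orthogonality in \<open>c\<close> singles out the fibre of trace 0; leaving out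
    \<open>c = 0\<close> costs the total number of points.\<close>
  have sum_S: "(\<Sum>c\<in>UNIV - {0}. S c (2 * m)) = of_real (q * real (card (Pts m 0)) - (q ^ (2 * m) - 1))"
    if "m > 0" for m
  proof -
    have "(\<Sum>c\<in>UNIV - {0}. S c (2 * m)) = (\<Sum>c\<in>UNIV - {0}. \<Sum>u\<in>UNIV. of_nat (card (Pts m u)) * \<psi> (c * u))"
      by (intro sum.cong refl S_eq that) auto
    also have "\<dots> = (\<Sum>c\<in>UNIV. \<Sum>u\<in>UNIV. of_nat (card (Pts m u)) * \<psi> (c * u)) - (\<Sum>u\<in>UNIV. of_nat (card (Pts m u)))"
      by (subst sum_diff1) auto
    also have "(\<Sum>c\<in>UNIV. \<Sum>u\<in>UNIV. of_nat (card (Pts m u)) * \<psi> (c * u)) =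
       (\<Sum>u\<in>UNIV. of_nat (card (Pts m u)) * (\<Sum>c\<in>UNIV. \<psi> (u * c)))"
      by (subst sum.swap) (simp add: sum_distrib_left mult.commute)
    also have "\<dots> = (\<Sum>u\<in>UNIV. if u = 0 then of_nat (card (Pts m u)) * of_nat CARD('a) else 0)"
      by (intro sum.cong refl) (simp add: sum_mult_UNIV)
    also have "\<dots> = of_real (q * real (card (Pts m 0)))"
      by (simp add: q_def mult.commute)
    also have "(\<Sum>u\<in>UNIV. of_nat (card (Pts m u)) :: complex) = of_real (\<Sum>u\<in>UNIV. real (card (Pts m u)))"
      by simp
    also have "\<dots> = of_real (q ^ (2 * m) - 1)"
      by (simp only: sum_X[OF that])
    finally show ?thesis by (simp only: of_real_diff)
  qed
  \<comment> \<open>A lower bound for \<open>Pts m 0\<close> is required here; it comes from the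
    upper bounds for the other \<open>q - 1\<close> fibres. After multiplication by \<open>q\<close>
    the terms of order above \<open>q^m\<close> cancel against the total.\<close>
  have upper: "- Re (\<Sum>c\<in>UNIV - {0}. S c (2 * m)) \<le> (q - 1) * (1 + 3 * q * q ^ m)" if "m > 0" for m
  proof -
    have X_le: "real (card (Pts m u)) \<le> q ^ (2 * m - 1) + 3 * q ^ m" for u
    proof -
      have "card (Pts m u) \<le> CARD('a) ^ (2 * m - 1) + 3 * CARD('a) ^ m"
        unfolding Pts_def by (rule card_frob_trace_eq_le[OF that])
      hence "real (card (Pts m u)) \<le> real (CARD('a) ^ (2 * m - 1) + 3 * CARD('a) ^ m)"
        by (rule of_nat_mono)
      thus ?thesis by (simp add: q_def)
    qed
    have "q ^ (2 * m) - 1 - real (card (Pts m 0)) = (\<Sum>u\<in>UNIV - {0}. real (card (Pts m u)))"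
      using sum_X[OF that] by (subst sum_diff1) auto
    also have "\<dots> \<le> (\<Sum>u\<in>UNIV - {0::'a}. q ^ (2 * m - 1) + 3 * q ^ m)"
      by (intro sum_mono X_le)
    also have "\<dots> = (q - 1) * (q ^ (2 * m - 1) + 3 * q ^ m)"
      using card_field_gt_1[where ?'a='a] by (simp add: q_def card_Diff_singleton of_nat_diff)
    finally have "q * (q ^ (2 * m) - 1 - real (card (Pts m 0))) \<le> q * ((q - 1) * (q ^ (2 * m - 1) + 3 * q ^ m))"
      using q by (intro mult_left_mono) auto
    also have "\<dots> = (q - 1) * (q * q ^ (2 * m - 1) + 3 * q * q ^ m)"
      by (simp add: algebra_simps)
    also have "q * q ^ (2 * m - 1) = q ^ (2 * m)"
      using that by (metis One_nat_def Suc_pred mult_pos_pos power_Suc zero_less_numeral)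
    finally have "q ^ (2 * m) - 1 - q * real (card (Pts m 0)) \<le> (q - 1) * (1 + 3 * q * q ^ m)"
      by (simp add: algebra_simps)
    thus ?thesis unfolding sum_S[OF that] by simp
  qed
  have K1: "K 1 = kloosterman a" by (simp add: K_def)
  have ex: "\<exists>\<alpha> \<beta>. \<alpha> + \<beta> = - K c \<and> \<alpha> * \<beta> = of_real q \<and>
      (\<forall>m. Re (\<alpha> ^ (2 * m) + \<beta> ^ (2 * m)) \<ge> - 2 * q ^ m) \<and>
      ((Re (K c))\<^sup>2 > 4 * q \<longrightarrow> (\<exists>r>q. \<forall>m. Re (\<alpha> ^ (2 * m) + \<beta> ^ (2 * m)) \<ge> r ^ m))"
    if "c \<noteq> 0" for c
  proof -
    have "0 < q" using q by simp
    obtain \<alpha> \<beta> where \<alpha>\<beta>: "\<alpha> + \<beta> = - of_real (Re (K c))" "\<alpha> * \<beta> = of_real q"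
        "\<And>m. Re (\<alpha> ^ (2 * m) + \<beta> ^ (2 * m)) \<ge> - 2 * q ^ m"
        "(Re (K c))\<^sup>2 > 4 * q \<Longrightarrow> \<exists>r>q. \<forall>m. Re (\<alpha> ^ (2 * m) + \<beta> ^ (2 * m)) \<ge> r ^ m"
      by (rule quadratic_power_sum_bounds[OF \<open>0 < q\<close>, of "Re (K c)"]) (rule that)
    have "\<alpha> + \<beta> = - K c" using \<alpha>\<beta>(1) K_real[OF \<open>c \<noteq> 0\<close>] by simp
    thus ?thesis using \<alpha>\<beta>(2-4) by blast
  qed
  have S_power: "- S c (2 * m) = \<alpha> ^ (2 * m) + \<beta> ^ (2 * m)"
    if "c \<noteq> 0" "m > 0" "\<alpha> + \<beta> = - K c" "\<alpha> * \<beta> = of_real q" for c m \<alpha> \<beta>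
  proof -
    have "S c (2 * m) = - (\<alpha> ^ (2 * m) + \<beta> ^ (2 * m))"
      unfolding S_def
      by (rule nontrivial_add_char.kloosterman_ext_eq_power_sum[OF tw[OF that(1)] a])
        (use that in \<open>simp_all add: K_def q_def\<close>)
    thus ?thesis by simp
  qed
  have lower: "- Re (S c (2 * m)) \<ge> - 2 * q ^ m" if "c \<noteq> 0" "m > 0" for c m
  proof -
    obtain \<alpha> \<beta> where \<alpha>\<beta>: "\<alpha> + \<beta> = - K c" "\<alpha> * \<beta> = of_real q"
        "Re (\<alpha> ^ (2 * m) + \<beta> ^ (2 * m)) \<ge> - 2 * q ^ m"
      using ex[OF \<open>c \<noteq> 0\<close>] by blast
    show ?thesis
      using \<alpha>\<beta>(3) unfolding S_power[OF that \<alpha>\<beta>(1,2), symmetric] by simp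
  qed
  have "(Re (K 1))\<^sup>2 \<le> 4 * q"
  proof (rule ccontr)
    assume "\<not> ?thesis"
    then obtain \<alpha> \<beta> r where r: "\<alpha> + \<beta> = - K 1" "\<alpha> * \<beta> = of_real q" "r > q"
        "\<And>m. Re (\<alpha> ^ (2 * m) + \<beta> ^ (2 * m)) \<ge> r ^ m"
      using ex[of 1] by (auto simp: not_le)
    \<comment> \<open>The remaining \<open>c\<close> are dropped at a price of at most
      \<open>2 * q^m\<close> each. Any factor independent of \<open>m\<close> would do;
      \<open>6 * q^2\<close> absorbs \<open>3 q^2 + q\<close> from \<open>upper\<close> and
      \<open>2 q\<close> from the dropped terms.\<close>
    have bound: "r ^ m \<le> (6 * q ^ 2) * q ^ m" if "m > 0" for m
    proof -
      have "r ^ m \<le> - Re (S 1 (2 * m))"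
        using r(4)[of m] unfolding S_power[OF one_neq_zero that r(1,2), symmetric] by simp
      also have "\<dots> = - Re (\<Sum>c\<in>UNIV - {0}. S c (2 * m)) - (\<Sum>c\<in>UNIV - {0} - {1}. - Re (S c (2 * m)))"
        by (subst sum.remove[of "UNIV - {0}" 1]) (auto simp: sum_negf)
      also have "\<dots> \<le> (q - 1) * (1 + 3 * q * q ^ m) - (\<Sum>c\<in>UNIV - {0} - {1 :: 'a}. - 2 * q ^ m)"
        by (intro diff_mono upper that sum_mono lower) auto
      also have "(\<Sum>c\<in>UNIV - {0} - {1 :: 'a}. - 2 * q ^ m) = real (card (UNIV - {0} - {1 :: 'a})) * (- 2 * q ^ m)"
        by simp
      also have "(q - 1) * (1 + 3 * q * q ^ m) - \<dots> \<le> (q - 1) * (1 + 3 * q * q ^ m) + q * (2 * q ^ m)"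
      proof -
        have "real (card (UNIV - {0} - {1 :: 'a})) \<le> q"
          unfolding q_def by (intro of_nat_mono card_mono) auto
        hence "real (card (UNIV - {0} - {1 :: 'a})) * (2 * q ^ m) \<le> q * (2 * q ^ m)"
          using q by (intro mult_right_mono) auto
        thus ?thesis by simp
      qed
      also have "\<dots> \<le> q * (1 * q ^ m + 3 * q * q ^ m) + q * (2 * q ^ m)"
        using q by (intro add_mono mult_mono) auto
      also have "\<dots> = (3 * q + 3 * q\<^sup>2) * q ^ m" by (simp add: algebra_simps power2_eq_square)
      also have "\<dots> \<le> (6 * q ^ 2) * q ^ m"
      proof (rule mult_right_mono)
        have "q * 1 \<le> q * q" using q by (intro mult_left_mono) auto
        thus "3 * q + 3 * q\<^sup>2 \<le> 6 * q ^ 2" by (simp add: power2_eq_square)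
      qed (use q in simp)
      finally show ?thesis .
    qed
    have "r / q > 1" using r(3) q by simp
    then obtain n where n: "6 * q ^ 2 < (r / q) ^ n" using real_arch_pow by blast
    \<comment> \<open>The exponent is raised by one because \<open>bound\<close> is stated for
      positive \<open>m\<close>, while \<open>n\<close> may be 0.\<close>
    also have "\<dots> \<le> (r / q) ^ Suc n"
      using \<open>r / q > 1\<close> by (intro power_increasing) auto
    finally have "6 * q ^ 2 * q ^ Suc n < r ^ Suc n"
      using q by (simp add: power_divide pos_less_divide_eq del: power_Suc)
    thus False using bound[of "Suc n"] by simp
  qed
  hence "(cmod (K 1))\<^sup>2 \<le> 4 * q"
    using K_real[of 1] by (auto elim!: Reals_cases)
  hence "cmod (K 1) \<le> sqrt (4 * q)" by (rule real_le_rsqrt)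
  thus ?thesis by (simp add: K1 real_sqrt_mult q_def)
qed

end

section \<open>Additive characters and Gauss sums\<close>

text \<open>From \<open>k^q = k\<close> the inverse of \<open>k\<close> is its power
  \<open>q - 2\<close>, again the image of an integer.\<close>

lemma ex_of_int_inverse:
  assumes "of_int k \<noteq> (0::'a::{field,finite})"
  obtains l :: int where "of_int l * of_int k = (1::'a)"
proof -
  have "CARD('a) \<ge> 2" using card_field_gt_1[where ?'a='a] by simp
  hence "CARD('a) = Suc (Suc (CARD('a) - 2))" by simp
  hence "of_int k * (of_int k * of_int k ^ (CARD('a) - 2)) = (of_int k :: 'a)"
    using field_power_card[of "of_int k :: 'a"] by (metis power_Suc)
  hence "of_int k * of_int k ^ (CARD('a) - 2) = (1 :: 'a)"
    using assms by (metis mult_cancel_left1 mult_cancel_left)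
  thus ?thesis using that[of "k ^ (CARD('a) - 2)"] by (simp add: mult.commute)
qed

text \<open>A maximal additive subgroup \<open>H\<close> without \<open>1\<close> satisfies \<open>H + \<int> = F\<close>, so that the character
  of \<open>F / H \<cong> \<int> / p\<int>\<close> can be pulled back.\<close>
lemma ex_nontrivial_add_char: "\<exists>\<psi> :: 'a::{field,finite} \<Rightarrow> complex. nontrivial_add_char \<psi>"
proof -
  define p where "p = CHAR('a)"
  have p: "p > 1"
    using prime_CHAR_semidom[where ?'a='a] finite_imp_CHAR_pos[where ?'a='a] prime_gt_1_nat
    by (auto simp: p_def)
  define SG where "SG = {H :: 'a set. 0 \<in> H \<and> 1 \<notin> H \<and> (\<forall>x\<in>H. \<forall>y\<in>H. x - y \<in> H)}"
  have "finite SG" by simp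
  moreover have "{0} \<in> SG" by (simp add: SG_def)
  ultimately obtain H where H: "H \<in> SG" "\<And>H'. H' \<in> SG \<Longrightarrow> H \<subseteq> H' \<Longrightarrow> H = H'"
    using finite_has_maximal[of SG] by blast
  have H0: "0 \<in> H" and H1: "1 \<notin> H" and Hd: "\<And>x y. x \<in> H \<Longrightarrow> y \<in> H \<Longrightarrow> x - y \<in> H"
    using H(1) by (auto simp: SG_def)
  have Hm: "- x \<in> H" if "x \<in> H" for x using Hd[OF H0 that] by simp
  have Ha: "x + y \<in> H" if "x \<in> H" "y \<in> H" for x y using Hd[OF that(1) Hm[OF that(2)]] by simp
  have Hn: "of_nat n * x \<in> H" if "x \<in> H" for x n
    by (induction n) (auto simp: H0 distrib_right intro: Ha that)
  have Hi: "of_int n * x \<in> H" if "x \<in> H" for x n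
    by (cases n rule: int_cases2) (use that Hn Hm in auto)
  have ker: "of_int k = (0::'a)" if "of_int k \<in> H" for k
  proof (rule ccontr)
    assume "of_int k \<noteq> (0::'a)"
    then obtain l where "of_int l * of_int k = (1::'a)" by (rule ex_of_int_inverse)
    thus False using Hi[OF that, of l] H1 by simp
  qed
  have ex: "\<exists>j::int. x - of_int j \<in> H" for x
  proof (cases "x \<in> H")
    case True
    thus ?thesis by (intro exI[of _ 0]) simp
  next
    case False
    \<comment> \<open>By maximality, adjoining \<open>x\<close> to \<open>H\<close> must produce 1,
      say \<open>1 = h + k * x\<close>. Multiplying by an integer inverse \<open>l\<close> of
      \<open>k\<close> gives \<open>x - l = - (l * h)\<close>, which lies in
      \<open>H\<close>.\<close>
    define H' where "H' = {h + of_int k * x | h k. h \<in> H}"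
    have "H \<subseteq> H'" by (force simp: H'_def intro: exI[of _ "0::int"])
    moreover have "x \<in> H'" using H0 by (force simp: H'_def intro: exI[of _ "1::int"])
    ultimately have "H' \<notin> SG" using H(2) False by blast
    moreover have "0 \<in> H'" using \<open>H \<subseteq> H'\<close> H0 by blast
    moreover have "u - v \<in> H'" if uv: "u \<in> H'" "v \<in> H'" for u v
    proof -
      obtain h k h' k' where "u = h + of_int k * x" "v = h' + of_int k' * x" "h \<in> H" "h' \<in> H"
        using uv by (auto simp: H'_def)
      hence "u - v = (h - h') + of_int (k - k') * x" "h - h' \<in> H"
        using Hd by (auto simp: algebra_simps)
      thus ?thesis unfolding H'_def by blast
    qed
    ultimately have "1 \<in> H'" by (auto simp: SG_def)
    then obtain h k where hk: "1 = h + of_int k * x" "h \<in> H" by (auto simp: H'_def)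
    have "of_int k \<noteq> (0::'a)" using hk H1 by auto
    then obtain l where l: "of_int l * of_int k = (1::'a)" by (rule ex_of_int_inverse)
    have "of_int l = of_int l * h + (of_int l * of_int k) * x"
      using arg_cong[OF hk(1), of "\<lambda>z. of_int l * z"] by (simp add: algebra_simps)
    hence "x = of_int l - of_int l * h" by (metis add_diff_cancel_left' l mult_1)
    hence "x - of_int l = - (of_int l * h)" by simp
    thus ?thesis using Hm[OF Hi[OF hk(2)]] by metis
  qed
  define e where "e = (\<lambda>j::int. cis (2 * pi * (of_int j / of_nat p)))"
  have e_add: "e (i + j) = e i * e j" for i j
    by (simp add: e_def cis_mult distrib_left add_divide_distrib)
  have e_cong: "e i = e j" if "of_int i = (of_int j :: 'a)" for i j
  proof -
    have "of_int (i - j) = (0::'a)" using that by simp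
    hence "int p dvd i - j" unfolding p_def by (subst (asm) of_int_eq_0_iff_char_dvd)
    then obtain m where "i - j = int p * m" by (elim dvdE)
    hence "of_int (i - j) / of_nat p = (of_int m :: real)" using p by simp
    hence "e (i - j) = 1"
      unfolding e_def by (simp only: cis_multiple_2pi Ints_of_int)
    thus ?thesis using e_add[of "i - j" j] by simp
  qed
  \<comment> \<open>The choice does not matter: two candidates differ by an integer whose image lies
    in \<open>H\<close>, hence is 0, and \<open>e\<close> depends only on the image of its argument
    in the field.\<close>
  define \<psi> where "\<psi> = (\<lambda>x. e (SOME j. x - of_int j \<in> H))"
  have \<psi>: "\<psi> x = e j" if "x - of_int j \<in> H" for x j
  proof -
    define i where "i = (SOME i. x - of_int i \<in> H)"
    have "x - of_int i \<in> H" unfolding i_def using that by (rule someI)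
    hence "of_int (j - i) \<in> H" using Hd[of "x - of_int i" "x - of_int j"] that by simp
    hence "of_int (j - i) = (0::'a)" by (rule ker)
    hence "e i = e j" by (intro e_cong) simp
    thus ?thesis by (simp add: \<psi>_def i_def)
  qed
  have "nontrivial_add_char \<psi>"
  proof
    fix x y
    obtain i j where ij: "x - of_int i \<in> H" "y - of_int j \<in> H" using ex by blast
    have "(x + y) - of_int (i + j) \<in> H" using Ha[OF ij] by (simp add: algebra_simps)
    thus "\<psi> (x + y) = \<psi> x * \<psi> y" using \<psi> ij by (simp only: e_add)
    show "cmod (\<psi> x) = 1" by (simp add: \<psi>_def e_def)
  next
    have "\<psi> 1 = e 1" by (rule \<psi>) (simp add: H0)
    moreover have "e 1 \<noteq> 1"
    proof
      assume "e 1 = 1"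
      hence "cos (2 * pi * (1 / real p)) = 1" by (simp add: e_def complex_eq_iff)
      then obtain n :: int where "2 * pi * (1 / real p) = of_int n * 2 * pi"
        unfolding cos_one_2pi_int by blast
      hence "1 = of_int n * real p" using p by (simp add: field_simps)
      hence "of_int 1 = (of_int (n * int p) :: real)" by simp
      hence "1 = n * int p" by (simp only: of_int_eq_iff)
      thus False using p by (metis dvd_triv_right int_dvd_int_iff nat_dvd_1_iff_1 of_nat_1 less_irrefl)
    qed
    ultimately show "\<exists>x. \<psi> x \<noteq> 1" by metis
  qed
  thus ?thesis by blast
qed

context nontrivial_add_char
begin

definition gauss_sum :: "'a \<Rightarrow> complex" where
  "gauss_sum c = (\<Sum>x\<in>UNIV. \<psi> (c * x\<^sup>2))"

lemma sum_quadratic: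
  assumes "(2::'a) \<noteq> 0" "c \<noteq> 0"
  shows "(\<Sum>x\<in>UNIV. \<psi> (c * x\<^sup>2 + b * x)) = \<psi> (- (b\<^sup>2 / (4 * c))) * gauss_sum c"
proof -
  define k where "k = b / (2 * c)"
  have b: "b = 2 * c * k" using assms by (simp add: k_def)
  have "4 * c \<noteq> 0"
    using assms by (metis mult_2 mult_eq_0_iff numeral_Bit0 numeral_plus_numeral)
  hence b2: "b\<^sup>2 / (4 * c) = c * k\<^sup>2"
    by (simp only: nonzero_divide_eq_eq b) (simp add: power2_eq_square)
  have "(\<Sum>x\<in>UNIV. \<psi> (c * x\<^sup>2 + b * x)) = (\<Sum>x\<in>UNIV. \<psi> (- (b\<^sup>2 / (4 * c)) + c * x\<^sup>2))"
  proof (rule sum.reindex_bij_witness[of _ "\<lambda>x. x - k" "\<lambda>x. x + k"])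
    fix x
    have "- (c * k\<^sup>2) + c * (x + k)\<^sup>2 = c * x\<^sup>2 + (2 * c * k) * x"
      by (simp add: algebra_simps power2_eq_square)
    thus "\<psi> (- (b\<^sup>2 / (4 * c)) + c * (x + k)\<^sup>2) = \<psi> (c * x\<^sup>2 + b * x)"
      by (simp only: b2 b[symmetric])
  qed auto
  thus ?thesis by (simp only: add[of "- (b\<^sup>2 / (4 * c))"] gauss_sum_def sum_distrib_left)
qed

text \<open>Substituting \<open>x = y + h\<close> in the double sum makes the exponent linear in
  \<open>y\<close>, so only \<open>h = 0\<close> survives.\<close>

lemma gauss_sum_norm:
  assumes "(2::'a) \<noteq> 0" "c \<noteq> 0"
  shows "(cmod (gauss_sum c))\<^sup>2 = real CARD('a)"
proof -
  have "of_real ((cmod (gauss_sum c))\<^sup>2) = cnj (gauss_sum c) * gauss_sum c"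
    by (simp only: complex_norm_square mult.commute)
  also have "\<dots> = (\<Sum>y\<in>UNIV. \<Sum>x\<in>UNIV. \<psi> (c * x\<^sup>2 - c * y\<^sup>2))"
    by (simp add: gauss_sum_def sum_product uminus[symmetric] add[symmetric])
  also have "\<dots> = (\<Sum>y\<in>UNIV. \<Sum>h\<in>UNIV. \<psi> (c * h\<^sup>2) * \<psi> ((2 * c * h) * y))"
  proof (rule sum.cong)
    fix y
    show "(\<Sum>x\<in>UNIV. \<psi> (c * x\<^sup>2 - c * y\<^sup>2)) = (\<Sum>h\<in>UNIV. \<psi> (c * h\<^sup>2) * \<psi> ((2 * c * h) * y))"
      by (rule sum.reindex_bij_witness[of _ "\<lambda>h. y + h" "\<lambda>x. x - y"])
        (auto simp: add[symmetric] power2_eq_square algebra_simps)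
  qed simp
  also have "\<dots> = (\<Sum>h\<in>UNIV. \<psi> (c * h\<^sup>2) * (\<Sum>y\<in>UNIV. \<psi> ((2 * c * h) * y)))"
    by (subst sum.swap) (simp add: sum_distrib_left)
  also have "\<dots> = (\<Sum>h\<in>(UNIV::'a set). if h = 0 then of_nat CARD('a) else 0)"
    by (intro sum.cong refl) (use assms in \<open>simp add: sum_mult_UNIV\<close>)
  finally have "complex_of_real ((cmod (gauss_sum c))\<^sup>2) = of_real (real CARD('a))" by simp
  thus ?thesis by (simp only: of_real_eq_iff)
qed

text \<open>The sign is the quadratic character of \<open>g\<close>. For a non-square
  \<open>g\<close>, the values \<open>x^2\<close> and \<open>g * x^2\<close> together hit every
  element exactly twice, so the two Gauss sums add up to twice a full character sum, which is
  0.\<close>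

lemma gauss_sum_scale:
  assumes g: "g \<noteq> 0"
  obtains \<epsilon> where "\<epsilon> = 1 \<or> \<epsilon> = - 1" "\<And>c. c \<noteq> 0 \<Longrightarrow> gauss_sum (g * c) = \<epsilon> * gauss_sum c"
proof (cases "\<exists>r. g = r\<^sup>2")
  case True
  then obtain r where r: "g = r\<^sup>2" by blast
  have "gauss_sum (g * c) = gauss_sum c" for c
    unfolding gauss_sum_def
    by (rule sum.reindex_bij_witness[of _ "\<lambda>x. x / r" "\<lambda>x. r * x"])
      (use g r in \<open>auto simp: power_mult_distrib mult_ac\<close>)
  thus ?thesis using that[of 1] by simp
next
  case False
  define N where "N = (\<lambda>y::'a. card {x. x\<^sup>2 = y})"
  define N' where "N' = (\<lambda>y::'a. card {x. g * x\<^sup>2 = y})"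
  have N'N: "N' y = N (y / g)" for y
  proof -
    have "{x. g * x\<^sup>2 = y} = {x. x\<^sup>2 = y / g}" using g by (auto simp: field_simps)
    thus ?thesis by (simp add: N_def N'_def)
  qed
  have N_le: "N y \<le> 2" for y
  proof (cases "\<exists>r. r\<^sup>2 = y")
    case True
    then obtain r where r: "r\<^sup>2 = y" by blast
    have "{x. x\<^sup>2 = y} \<subseteq> {r, - r}" using r by (auto simp: power2_eq_iff)
    hence "N y \<le> card {r, - r}" unfolding N_def by (intro card_mono) auto
    also have "\<dots> \<le> 2" by (simp add: card_insert_if)
    finally show ?thesis .
  next
    case False
    hence "{x. x\<^sup>2 = y} = {}" by auto
    thus ?thesis by (simp add: N_def)
  qed
  have le: "N y + N' y \<le> 2" for y
  proof (cases "y = 0")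
    case True
    have "{x :: 'a. x\<^sup>2 = 0} = {0}" by auto
    hence "N 0 = 1" by (simp add: N_def)
    thus ?thesis using True by (simp add: N'N)
  next
    case y: False
    show ?thesis
    proof (cases "\<exists>x. x\<^sup>2 = y")
      case True
      then obtain x where x: "x\<^sup>2 = y" by blast
      have "\<not> g * z\<^sup>2 = y" for z
      proof
        assume z: "g * z\<^sup>2 = y"
        hence "z \<noteq> 0" using y by auto
        hence "g = (x / z)\<^sup>2" using z x by (simp add: power_divide field_simps)
        thus False using False by blast
      qed
      hence "{z. g * z\<^sup>2 = y} = {}" by auto
      hence "N' y = 0" by (simp add: N'_def)
      thus ?thesis using N_le[of y] by simp
    next
      case False
      hence "{x. x\<^sup>2 = y} = {}" by auto
      hence "N y = 0" by (simp add: N_def)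
      thus ?thesis using N_le[of "y / g"] by (simp add: N'N)
    qed
  qed
  have fibre: "(\<Sum>x\<in>UNIV. \<phi> (f x)) = (\<Sum>y\<in>UNIV. of_nat (card {x. f x = y}) * \<phi> y)"
    for \<phi> :: "'a \<Rightarrow> complex" and f :: "'a \<Rightarrow> 'a"
  proof -
    have "(\<Sum>x\<in>UNIV. \<phi> (f x)) = (\<Sum>y\<in>UNIV. \<Sum>x\<in>{x. x \<in> UNIV \<and> f x = y}. \<phi> (f x))"
      by (rule sum.group[symmetric]) auto
    thus ?thesis by simp
  qed
  \<comment> \<open>Pointwise the counts are at most 2 and in total they reach
    \<open>2 * CARD('a)\<close>, which forces equality everywhere; \<open>le\<close> makes the
    subtraction on naturals exact.\<close>
  have "(\<Sum>y\<in>UNIV. 2 - (N y + N' y)) = 0"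
  proof -
    have c: "(\<Sum>y\<in>UNIV. card {x. f x = y}) = CARD('a)" for f :: "'a \<Rightarrow> 'a"
    proof -
      have "complex_of_nat CARD('a) = of_nat (\<Sum>y\<in>UNIV. card {x. f x = y})"
        using fibre[of "\<lambda>_. 1" f] by simp
      thus ?thesis by (simp only: of_nat_eq_iff)
    qed
    have "(\<Sum>y\<in>UNIV. 2 - (N y + N' y)) = (\<Sum>y\<in>(UNIV::'a set). 2) - (\<Sum>y\<in>UNIV. N y + N' y)"
      by (rule sum_subtractf_nat) (use le in auto)
    also have "(\<Sum>y\<in>UNIV. N y + N' y) = 2 * CARD('a)"
      by (simp add: sum.distrib N_def N'_def c)
    finally show ?thesis by simp
  qed
  hence "2 - (N y + N' y) = 0" for y by simp
  hence eq: "N y + N' y = 2" for y using le[of y] by (metis diff_is_0_eq le_antisym)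
  have "gauss_sum (g * c) = - 1 * gauss_sum c" if "c \<noteq> 0" for c
  proof -
    have "gauss_sum c + gauss_sum (g * c) = (\<Sum>y\<in>UNIV. of_nat (N y) * \<psi> (c * y)) + (\<Sum>y\<in>UNIV. of_nat (N' y) * \<psi> (c * y))"
      using fibre[of "\<lambda>y. \<psi> (c * y)" "\<lambda>x. x\<^sup>2"] fibre[of "\<lambda>y. \<psi> (c * y)" "\<lambda>x. g * x\<^sup>2"]
      by (simp add: gauss_sum_def N_def N'_def mult_ac)
    also have "\<dots> = (\<Sum>y\<in>UNIV. of_nat (N y + N' y) * \<psi> (c * y))"
      by (simp add: sum.distrib distrib_right)
    also have "\<dots> = 2 * (\<Sum>y\<in>UNIV. \<psi> (c * y))"
      by (simp only: eq) (simp add: sum_distrib_left)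
    also have "\<dots> = 0" using that by (simp add: sum_mult_UNIV)
    finally show ?thesis by (simp add: add_eq_0_iff)
  qed
  thus ?thesis using that[of "- 1"] by blast
qed

text \<open>Completing the square in \<open>c * s * x^2 + s * x\<close> yields
  \<open>\<psi> (- (s / (4 * c)))\<close> times \<open>gauss_sum (s * c)\<close>, and
  \<open>gauss_sum_scale\<close> removes \<open>s\<close> up to a sign. Read backwards, this opens
  the Gauss sum; summing over \<open>c\<close> first then detects \<open>s * x^2 = t\<close>, which
  has at most two solutions.\<close>

lemma salie_sum_bound:
  assumes "(2::'a) \<noteq> 0" "t \<noteq> 0"
  shows "cmod (\<Sum>c\<in>UNIV - {0}. \<psi> (- (c * t)) * \<psi> (- (s / (4 * c))) * gauss_sum c) \<le> 2 * real CARD('a)"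
proof -
  have eval: "(\<Sum>c\<in>UNIV - {0}. \<psi> (- (c * t)) * (\<Sum>x\<in>UNIV. \<psi> ((c * g) * x\<^sup>2 + b * x))) =
      of_nat CARD('a) * (\<Sum>x | g * x\<^sup>2 = t. \<psi> (b * x)) - (\<Sum>x\<in>UNIV. \<psi> (b * x))" for b g
  proof -
    let ?f = "\<lambda>c. \<psi> (- (c * t)) * (\<Sum>x\<in>UNIV. \<psi> ((c * g) * x\<^sup>2 + b * x))"
    have "(\<Sum>c\<in>UNIV. ?f c) = (\<Sum>x\<in>UNIV. \<psi> (b * x) * (\<Sum>c\<in>UNIV. \<psi> ((g * x\<^sup>2 - t) * c)))"
      unfolding sum_distrib_left
      by (subst sum.swap) (intro sum.cong refl, simp add: add[symmetric] algebra_simps)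
    also have "\<dots> = (\<Sum>x\<in>UNIV. if g * x\<^sup>2 = t then of_nat CARD('a) * \<psi> (b * x) else 0)"
      by (intro sum.cong refl) (simp add: sum_mult_UNIV)
    also have "\<dots> = of_nat CARD('a) * (\<Sum>x | g * x\<^sup>2 = t. \<psi> (b * x))"
      by (simp add: sum.If_cases sum_distrib_left)
    finally show ?thesis by (subst sum_diff1) auto
  qed
  have card_le: "card {x. g * x\<^sup>2 = t} \<le> 2" for g
  proof (cases "\<exists>r. g * r\<^sup>2 = t")
    case True
    then obtain r where r: "g * r\<^sup>2 = t" by blast
    hence "g \<noteq> 0" using assms by auto
    have "{x. g * x\<^sup>2 = t} \<subseteq> {r, - r}"
    proof
      fix x assume "x \<in> {x. g * x\<^sup>2 = t}"
      hence "g * x\<^sup>2 = g * r\<^sup>2" using r by simp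
      hence "x\<^sup>2 = r\<^sup>2" using \<open>g \<noteq> 0\<close> by simp
      thus "x \<in> {r, - r}" by (simp add: power2_eq_iff)
    qed
    hence "card {x. g * x\<^sup>2 = t} \<le> card {r, - r}" by (intro card_mono) auto
    also have "\<dots> \<le> 2" by (simp add: card_insert_if)
    finally show ?thesis .
  next
    case False
    hence "{x. g * x\<^sup>2 = t} = {}" by auto
    thus ?thesis by (simp only: card.empty)
  qed
  show ?thesis
  \<comment> \<open>For \<open>s = 0\<close> the omitted term \<open>c = 0\<close> is
    \<open>q\<close> and does not vanish: the sum is \<open>q\<close> times one less than the number
    of square roots of \<open>t\<close>.\<close>
  proof (cases "s = 0")
    case True
    have "(\<Sum>c\<in>UNIV - {0}. \<psi> (- (c * t)) * \<psi> (- (s / (4 * c))) * gauss_sum c) =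
        of_real (real CARD('a) * (real (card {x. 1 * x\<^sup>2 = t}) - 1))"
      using eval[of 1 0] True by (simp add: gauss_sum_def algebra_simps)
    also have "cmod \<dots> \<le> 2 * real CARD('a)"
    proof -
      have "\<bar>real (card {x. 1 * x\<^sup>2 = t}) - 1\<bar> \<le> 1" using card_le[of 1] by simp
      hence "real CARD('a) * \<bar>real (card {x. 1 * x\<^sup>2 = t}) - 1\<bar> \<le> real CARD('a) * 1"
        by (intro mult_left_mono) auto
      thus ?thesis by (simp only: norm_of_real abs_mult)
    qed
    finally show ?thesis .
  next
    case False
    obtain \<epsilon> where \<epsilon>: "\<epsilon> = 1 \<or> \<epsilon> = - 1" "\<And>c. c \<noteq> 0 \<Longrightarrow> gauss_sum (s * c) = \<epsilon> * gauss_sum c"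
      using gauss_sum_scale[OF False] by blast
    have "\<epsilon> * (\<Sum>c\<in>UNIV - {0}. \<psi> (- (c * t)) * \<psi> (- (s / (4 * c))) * gauss_sum c) =
        (\<Sum>c\<in>UNIV - {0}. \<psi> (- (c * t)) * (\<Sum>x\<in>UNIV. \<psi> ((c * s) * x\<^sup>2 + s * x)))"
      unfolding sum_distrib_left[of \<epsilon>]
    proof (intro sum.cong refl)
      fix c :: 'a assume c: "c \<in> UNIV - {0}"
      have "(\<Sum>x\<in>UNIV. \<psi> ((c * s) * x\<^sup>2 + s * x)) = \<psi> (- (s\<^sup>2 / (4 * (c * s)))) * gauss_sum (s * c)"
        using sum_quadratic[of "c * s" s] assms c False by (simp add: mult.commute)
      also have "s\<^sup>2 / (4 * (c * s)) = s / (4 * c)"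
        using False by (simp add: power2_eq_square)
      finally show "\<epsilon> * (\<psi> (- (c * t)) * \<psi> (- (s / (4 * c))) * gauss_sum c) =
          \<psi> (- (c * t)) * (\<Sum>x\<in>UNIV. \<psi> ((c * s) * x\<^sup>2 + s * x))"
        using c \<epsilon>(2)[of c] by simp
    qed
    also have "\<dots> = of_nat CARD('a) * (\<Sum>x | s * x\<^sup>2 = t. \<psi> (s * x))"
      unfolding eval using False by (simp add: sum_mult_UNIV)
    finally have eq: "\<epsilon> * (\<Sum>c\<in>UNIV - {0}. \<psi> (- (c * t)) * \<psi> (- (s / (4 * c))) * gauss_sum c) =
        of_nat CARD('a) * (\<Sum>x | s * x\<^sup>2 = t. \<psi> (s * x))" .
    have "cmod \<epsilon> = 1" using \<epsilon>(1) by auto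
    hence "cmod (\<Sum>c\<in>UNIV - {0}. \<psi> (- (c * t)) * \<psi> (- (s / (4 * c))) * gauss_sum c) =
        real CARD('a) * cmod (\<Sum>x | s * x\<^sup>2 = t. \<psi> (s * x))"
      using arg_cong[OF eq, of cmod] by (simp add: norm_mult)
    also have "cmod (\<Sum>x | s * x\<^sup>2 = t. \<psi> (s * x)) \<le> (\<Sum>x | s * x\<^sup>2 = t. 1)"
      by (rule sum_norm_le) simp
    also have "\<dots> \<le> 2" using card_le[of s] by simp
    finally show ?thesis by (simp add: mult_left_mono)
  qed
qed

text \<open>The substitution \<open>x = - (c * t)\<close> turns the exponent into
  \<open>x + a / x\<close> with \<open>a = t * s / 4\<close>. For \<open>s = 0\<close> this
  \<open>a\<close> vanishes, outside the scope of Weil's bound, but then the sum is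
  \<open>-1\<close>.\<close>

lemma kloosterman_sum_bound:
  assumes "(2::'a) \<noteq> 0" "t \<noteq> 0"
  shows "cmod (\<Sum>c\<in>UNIV - {0}. \<psi> (- (c * t)) * \<psi> (- (s / (4 * c)))) \<le> 2 * sqrt (real CARD('a))"
proof (cases "s = 0")
  case True
  have "(\<Sum>c\<in>UNIV - {0}. \<psi> ((- t) * c)) = - 1"
    using assms by (subst sum_diff1) (auto simp: sum_mult_UNIV simp del: mult_minus_left)
  hence "cmod (\<Sum>c\<in>UNIV - {0}. \<psi> (- (c * t)) * \<psi> (- (s / (4 * c)))) = 1"
    using True by (simp add: mult.commute)
  moreover have "1 \<le> sqrt (real CARD('a))"
    using card_field_gt_1[where ?'a='a] by simp
  ultimately show ?thesis by linarith
next
  case False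
  have 4: "(4::'a) \<noteq> 0"
    using assms(1) by (metis mult_2 mult_eq_0_iff numeral_Bit0 numeral_plus_numeral)
  have "(\<Sum>c\<in>UNIV - {0}. \<psi> (- (c * t)) * \<psi> (- (s / (4 * c)))) = kloosterman (t * s / 4)"
    unfolding kloosterman_def
    by (rule sum.reindex_bij_witness[of _ "\<lambda>x. - x / t" "\<lambda>c. - (c * t)"])
      (use assms 4 in \<open>auto simp: add[symmetric] field_simps\<close>)
  thus ?thesis using kloosterman_bound[of "t * s / 4"] assms 4 False by simp
qed

text \<open>Even powers of \<open>gauss_sum c\<close> do not depend on \<open>c\<close> and come out
  of the sum. For even \<open>d\<close> a Kloosterman sum remains, giving \<open>q^(d/2)\<close>
  times \<open>2 q^(1/2)\<close>; for odd \<open>d\<close> one Gauss sum stays inside, giving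
  \<open>q^((d-1)/2)\<close> times \<open>2 q\<close>. Both products agree.\<close>

lemma quadratic_exponential_sum_bound:
  assumes "(2::'a) \<noteq> 0" "t \<noteq> 0"
  shows "cmod (\<Sum>c\<in>UNIV - {0}. \<psi> (- (c * t)) * \<psi> (- (s / (4 * c))) * gauss_sum c ^ d)
           \<le> 2 * sqrt (real CARD('a)) ^ (d + 1)"
proof -
  define q where "q = real CARD('a)"
  have q: "q > 0" by (simp add: q_def)
  have sq: "gauss_sum c ^ 2 = gauss_sum 1 ^ 2" if "c \<noteq> 0" for c
  proof -
    obtain \<epsilon> where \<epsilon>: "\<epsilon> = 1 \<or> \<epsilon> = - 1" "\<And>b. b \<noteq> 0 \<Longrightarrow> gauss_sum (c * b) = \<epsilon> * gauss_sum b"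
      using gauss_sum_scale[OF \<open>c \<noteq> 0\<close>] by blast
    have "gauss_sum c = \<epsilon> * gauss_sum 1" using \<epsilon>(2)[of 1] by simp
    thus ?thesis using \<epsilon>(1) by auto
  qed
  have ev: "gauss_sum c ^ (2 * e) = gauss_sum 1 ^ (2 * e)" if "c \<noteq> 0" for c e
    using sq[OF that] by (simp add: power_mult)
  have nrm: "cmod (gauss_sum 1 ^ (2 * e)) = sqrt q ^ (2 * e)" for e
  proof -
    have "cmod (gauss_sum 1 ^ (2 * e)) = q ^ e"
      using gauss_sum_norm[OF assms(1), of 1] by (simp add: norm_power power_mult q_def)
    also have "\<dots> = sqrt q ^ (2 * e)" using q by (simp add: power_mult)
    finally show ?thesis .
  qed
  show ?thesis
  proof (cases "even d")
    case True
    then obtain e where d: "d = 2 * e" by (elim evenE)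
    have "(\<Sum>c\<in>UNIV - {0}. \<psi> (- (c * t)) * \<psi> (- (s / (4 * c))) * gauss_sum c ^ d) =
      gauss_sum 1 ^ (2 * e) * (\<Sum>c\<in>UNIV - {0}. \<psi> (- (c * t)) * \<psi> (- (s / (4 * c))))"
      unfolding sum_distrib_left
    proof (intro sum.cong refl)
      fix c :: 'a assume "c \<in> UNIV - {0}"
      hence "gauss_sum c ^ d = gauss_sum 1 ^ (2 * e)" unfolding d by (intro ev) simp
      thus "\<psi> (- (c * t)) * \<psi> (- (s / (4 * c))) * gauss_sum c ^ d =
          gauss_sum 1 ^ (2 * e) * (\<psi> (- (c * t)) * \<psi> (- (s / (4 * c))))"
        by simp
    qed
    hence "cmod (\<Sum>c\<in>UNIV - {0}. \<psi> (- (c * t)) * \<psi> (- (s / (4 * c))) * gauss_sum c ^ d) =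
       sqrt q ^ d * cmod (\<Sum>c\<in>UNIV - {0}. \<psi> (- (c * t)) * \<psi> (- (s / (4 * c))))"
      by (simp only: norm_mult nrm d)
    also have "\<dots> \<le> sqrt q ^ d * (2 * sqrt q)"
      using kloosterman_sum_bound[OF assms] q by (intro mult_left_mono) (auto simp: q_def)
    also have "\<dots> = 2 * sqrt q ^ (d + 1)" by simp
    finally show ?thesis by (simp only: q_def)
  next
    case False
    then obtain e where d: "d = 2 * e + 1" by (elim oddE)
    have "(\<Sum>c\<in>UNIV - {0}. \<psi> (- (c * t)) * \<psi> (- (s / (4 * c))) * gauss_sum c ^ d) =
      gauss_sum 1 ^ (2 * e) * (\<Sum>c\<in>UNIV - {0}. \<psi> (- (c * t)) * \<psi> (- (s / (4 * c))) * gauss_sum c)"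
      unfolding sum_distrib_left
    proof (intro sum.cong refl)
      fix c :: 'a assume "c \<in> UNIV - {0}"
      hence "gauss_sum c ^ (2 * e) = gauss_sum 1 ^ (2 * e)" by (intro ev) simp
      hence "gauss_sum c ^ d = gauss_sum 1 ^ (2 * e) * gauss_sum c"
        unfolding d by (simp only: power_add power_one_right)
      thus "\<psi> (- (c * t)) * \<psi> (- (s / (4 * c))) * gauss_sum c ^ d =
          gauss_sum 1 ^ (2 * e) * (\<psi> (- (c * t)) * \<psi> (- (s / (4 * c))) * gauss_sum c)"
        by simp
    qed
    hence "cmod (\<Sum>c\<in>UNIV - {0}. \<psi> (- (c * t)) * \<psi> (- (s / (4 * c))) * gauss_sum c ^ d) =
       sqrt q ^ (2 * e) * cmod (\<Sum>c\<in>UNIV - {0}. \<psi> (- (c * t)) * \<psi> (- (s / (4 * c))) * gauss_sum c)"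
      by (simp only: norm_mult nrm)
    also have "\<dots> \<le> sqrt q ^ (2 * e) * (2 * q)"
      using salie_sum_bound[OF assms] q by (intro mult_left_mono) (auto simp: q_def)
    also have "\<dots> = 2 * (sqrt q ^ (2 * e) * sqrt q ^ 2)" using q by simp
    also have "sqrt q ^ (2 * e) * sqrt q ^ 2 = sqrt q ^ (d + 1)"
      unfolding power_add[symmetric] d by simp
    finally show ?thesis by (simp only: q_def)
  qed
qed

end

section \<open>Fourier analysis of the sphere\<close>

lemma sum_vec_prod:
  fixes g :: "'d::finite \<Rightarrow> 'a::finite \<Rightarrow> complex"
  shows "(\<Sum>v\<in>(UNIV :: ('a ^ 'd) set). \<Prod>i\<in>UNIV. g i (v $ i)) = (\<Prod>i\<in>UNIV. \<Sum>a\<in>UNIV. g i a)"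
proof -
  have "(\<Prod>i\<in>UNIV. \<Sum>a\<in>UNIV. g i a) = (\<Sum>h\<in>PiE UNIV (\<lambda>_. UNIV). \<Prod>i\<in>UNIV. g i (h i))"
    by (rule prod_sum_PiE) auto
  also have "\<dots> = (\<Sum>v\<in>(UNIV :: ('a ^ 'd) set). \<Prod>i\<in>UNIV. g i (v $ i))"
    by (rule sum.reindex_bij_witness[of _ vec_nth vec_lambda]) (auto simp: PiE_UNIV_domain)
  finally show ?thesis ..
qed

definition dot :: "'a::field ^ 'd::finite \<Rightarrow> 'a ^ 'd \<Rightarrow> 'a" where
  "dot x y = (\<Sum>i\<in>UNIV. x $ i * y $ i)"

lemma dot_diff_right: "dot x (y - z) = dot x y - dot x z"
  by (simp add: dot_def right_diff_distrib sum_subtractf)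

context nontrivial_add_char
begin

text \<open>Unnormalised, so \<open>fourier_conv\<close> is free of constants and
  \<open>parseval\<close> carries \<open>q^d\<close>.\<close>

definition fourier :: "('a ^ 'd::finite \<Rightarrow> complex) \<Rightarrow> 'a ^ 'd \<Rightarrow> complex" where
  "fourier f \<xi> = (\<Sum>x\<in>UNIV. f x * \<psi> (dot \<xi> x))"

lemma sum_dot:
  fixes x :: "'a ^ 'd::finite"
  shows "(\<Sum>\<xi>\<in>UNIV. \<psi> (dot \<xi> x)) = (if x = 0 then of_nat CARD('a) ^ CARD('d) else 0)"
proof -
  have "(\<Sum>\<xi>\<in>UNIV. \<psi> (dot \<xi> x)) = (\<Prod>i\<in>UNIV. \<Sum>a\<in>UNIV. \<psi> (x $ i * a))"
    unfolding dot_def sum_eq_prod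
    by (subst sum_vec_prod[symmetric]) (simp add: mult.commute)
  also have "\<dots> = (\<Prod>i\<in>UNIV. if x $ i = 0 then of_nat CARD('a) else 0)"
    by (intro prod.cong refl) (simp add: sum_mult_UNIV)
  also have "\<dots> = (if x = 0 then of_nat CARD('a) ^ CARD('d) else 0)"
    by (auto simp: vec_eq_iff)
  finally show ?thesis .
qed

lemma parseval:
  fixes f :: "'a ^ 'd::finite \<Rightarrow> complex"
  shows "(\<Sum>\<xi>\<in>UNIV. (cmod (fourier f \<xi>))\<^sup>2) = real CARD('a) ^ CARD('d) * (\<Sum>x\<in>UNIV. (cmod (f x))\<^sup>2)"
proof -
  have "complex_of_real (\<Sum>\<xi>\<in>UNIV. (cmod (fourier f \<xi>))\<^sup>2) = (\<Sum>\<xi>\<in>UNIV. fourier f \<xi> * cnj (fourier f \<xi>))"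
    by (simp only: of_real_sum complex_norm_square)
  also have "\<dots> = (\<Sum>\<xi>\<in>UNIV. \<Sum>x\<in>UNIV. \<Sum>y\<in>UNIV. f x * cnj (f y) * \<psi> (dot \<xi> (x - y)))"
  proof (rule sum.cong)
    fix \<xi> :: "'a ^ 'd"
    have "f x * \<psi> (dot \<xi> x) * cnj (f y * \<psi> (dot \<xi> y)) = f x * cnj (f y) * \<psi> (dot \<xi> (x - y))" for x y
    proof -
      have "\<psi> (dot \<xi> (x - y)) = \<psi> (dot \<xi> x) * cnj (\<psi> (dot \<xi> y))"
        using add[of "dot \<xi> x" "- dot \<xi> y"] by (simp add: dot_diff_right uminus)
      thus ?thesis by simp
    qed
    thus "fourier f \<xi> * cnj (fourier f \<xi>) = (\<Sum>x\<in>UNIV. \<Sum>y\<in>UNIV. f x * cnj (f y) * \<psi> (dot \<xi> (x - y)))"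
      unfolding fourier_def cnj_sum sum_product by (intro sum.cong refl)
  qed simp
  also have "\<dots> = (\<Sum>x\<in>UNIV. \<Sum>y\<in>UNIV. f x * cnj (f y) * (\<Sum>\<xi>\<in>UNIV. \<psi> (dot \<xi> (x - y))))"
    unfolding sum_distrib_left by (rule trans[OF sum.swap], rule sum.cong[OF refl], rule sum.swap)
  also have "\<dots> = (\<Sum>x\<in>UNIV. \<Sum>y\<in>UNIV. if y = x then f x * cnj (f x) * of_nat CARD('a) ^ CARD('d) else 0)"
    by (intro sum.cong refl) (auto simp: sum_dot)
  also have "\<dots> = (\<Sum>x\<in>UNIV. f x * cnj (f x) * of_nat CARD('a) ^ CARD('d))"
    by simp
  also have "\<dots> = complex_of_real (real CARD('a) ^ CARD('d) * (\<Sum>x\<in>UNIV. (cmod (f x))\<^sup>2))"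
    unfolding of_real_mult of_real_sum complex_norm_square sum_distrib_left
    by (intro sum.cong refl) simp
  finally show ?thesis by (simp only: of_real_eq_iff)
qed

lemma fourier_conv:
  fixes f g :: "'a ^ 'd::finite \<Rightarrow> real"
  shows "fourier (\<lambda>x. of_real (conv f g x)) \<xi> = fourier (\<lambda>x. of_real (f x)) \<xi> * fourier (\<lambda>x. of_real (g x)) \<xi>"
proof -
  have "fourier (\<lambda>x. of_real (conv f g x)) \<xi> =
      (\<Sum>y\<in>UNIV. \<Sum>x\<in>UNIV. of_real (f y) * of_real (g (x - y)) * \<psi> (dot \<xi> x))"
    unfolding fourier_def conv_def of_real_sum of_real_mult sum_distrib_right
    by (rule sum.swap)
  also have "\<dots> = (\<Sum>y\<in>UNIV. \<Sum>z\<in>UNIV. of_real (f y) * \<psi> (dot \<xi> y) * (of_real (g z) * \<psi> (dot \<xi> z)))"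
  proof (rule sum.cong[OF refl])
    fix y :: "'a ^ 'd"
    show "(\<Sum>x\<in>UNIV. complex_of_real (f y) * of_real (g (x - y)) * \<psi> (dot \<xi> x)) =
        (\<Sum>z\<in>UNIV. of_real (f y) * \<psi> (dot \<xi> y) * (of_real (g z) * \<psi> (dot \<xi> z)))"
      by (rule sum.reindex_bij_witness[of _ "\<lambda>z. z + y" "\<lambda>x. x - y"])
        (auto simp: dot_diff_right add[symmetric])
  qed
  finally show ?thesis by (simp add: fourier_def sum_product)
qed

text \<open>In the expansion of the sphere as a sum over all \<open>c\<close>, the term
  \<open>c = 0\<close> is exactly the subtracted \<open>1 / q\<close>, so no frequency is
  exceptional. For \<open>c \<noteq> 0\<close> the sum over \<open>x\<close> factors over the
  coordinates into quadratic sums in one variable.\<close>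

lemma fourier_sphere_bound:
  fixes \<xi> :: "'a ^ 'd::finite"
  assumes "(2::'a) \<noteq> 0" "t \<noteq> 0"
  shows "cmod (fourier (\<lambda>x. of_real (sphere_ind t x - 1 / real CARD('a))) \<xi>)
     \<le> 2 * sqrt (real CARD('a)) ^ (CARD('d) + 1) / real CARD('a)"
proof -
  let ?q = "complex_of_nat CARD('a)"
  have sphere: "of_real (sphere_ind t x - 1 / real CARD('a)) = (\<Sum>c\<in>UNIV - {0}. \<psi> (c * (qnorm x - t))) / ?q"
    for x :: "'a ^ 'd"
  proof -
    have "(\<Sum>c\<in>UNIV. \<psi> ((qnorm x - t) * c)) = ?q * of_real (sphere_ind t x)"
      by (simp add: sum_mult_UNIV sphere_ind_def)
    hence "(\<Sum>c\<in>UNIV - {0}. \<psi> (c * (qnorm x - t))) = ?q * of_real (sphere_ind t x) - 1"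
      by (subst sum_diff1) (simp_all add: mult.commute)
    thus ?thesis by (simp add: diff_divide_distrib)
  qed
  have inner: "(\<Sum>x\<in>UNIV. \<psi> (c * qnorm x + dot \<xi> x)) = \<psi> (- (qnorm \<xi> / (4 * c))) * gauss_sum c ^ CARD('d)"
    if "c \<noteq> 0" for c
  proof -
    have "\<psi> (c * qnorm x + dot \<xi> x) = (\<Prod>i\<in>UNIV. \<psi> (c * (x $ i)\<^sup>2 + \<xi> $ i * x $ i))" for x
      by (simp add: qnorm_def dot_def sum_distrib_left sum_eq_prod[symmetric] sum.distrib)
    hence "(\<Sum>x\<in>UNIV. \<psi> (c * qnorm x + dot \<xi> x)) = (\<Prod>i\<in>UNIV. \<Sum>a\<in>UNIV. \<psi> (c * a\<^sup>2 + \<xi> $ i * a))"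
      by (simp only: sum_vec_prod[of "\<lambda>i a. \<psi> (c * a\<^sup>2 + \<xi> $ i * a)"])
    also have "\<dots> = (\<Prod>i\<in>UNIV. \<psi> (- ((\<xi> $ i)\<^sup>2 / (4 * c))) * gauss_sum c)"
      by (intro prod.cong refl sum_quadratic assms that)
    also have "\<dots> = \<psi> (\<Sum>i\<in>UNIV. - ((\<xi> $ i)\<^sup>2 / (4 * c))) * gauss_sum c ^ CARD('d)"
      by (simp add: prod.distrib sum_eq_prod)
    also have "(\<Sum>i\<in>UNIV. - ((\<xi> $ i)\<^sup>2 / (4 * c))) = - (qnorm \<xi> / (4 * c))"
      by (simp add: qnorm_def sum_negf sum_divide_distrib)
    finally show ?thesis .
  qed
  have "fourier (\<lambda>x. of_real (sphere_ind t x - 1 / real CARD('a))) \<xi> =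
      (\<Sum>x\<in>UNIV. \<Sum>c\<in>UNIV - {0}. \<psi> (- (c * t)) * \<psi> (c * qnorm x + dot \<xi> x)) / ?q"
    unfolding fourier_def sphere sum_divide_distrib sum_distrib_right
    by (intro sum.cong refl) (simp add: add[symmetric] algebra_simps)
  also have "\<dots> = (\<Sum>c\<in>UNIV - {0}. \<psi> (- (c * t)) * (\<Sum>x\<in>UNIV. \<psi> (c * qnorm x + dot \<xi> x))) / ?q"
    by (subst sum.swap) (simp add: sum_distrib_left)
  also have "\<dots> = (\<Sum>c\<in>UNIV - {0}. \<psi> (- (c * t)) * \<psi> (- (qnorm \<xi> / (4 * c))) * gauss_sum c ^ CARD('d)) / ?q"
    by (intro arg_cong[of _ _ "\<lambda>z. z / ?q"] sum.cong refl) (simp add: inner)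
  finally show ?thesis
    using quadratic_exponential_sum_bound[OF assms, of "qnorm \<xi>" "CARD('d)"]
    by (simp only: norm_divide norm_of_nat) (rule divide_right_mono, simp_all)
qed

end

section \<open>Second moment of the counts and selection of the good points\<close>

lemma conv_sphere_variance_le:
  fixes t :: "'a::{field,finite}" and E :: "('a ^ 'd::finite) set"
  assumes "odd CARD('a)" "t \<noteq> 0"
  shows "(\<Sum>x\<in>UNIV. (conv (indicator E) (sphere_ind t) x - real (card E) / real CARD('a))\<^sup>2)
           \<le> 4 * real CARD('a) ^ (CARD('d) - 1) * real (card E)"
proof -
  define q where "q = real CARD('a)"
  have q: "q > 0" by (simp add: q_def)
  \<comment> \<open>If 2 vanished, an odd \<open>q\<close> would be 1 in the field, whereas
    \<open>q\<close> is 0 there.\<close>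
  have two: "(2::'a) \<noteq> 0"
  proof
    assume 2: "(2::'a) = 0"
    obtain k where "CARD('a) = 2 * k + 1" using assms(1) by (elim oddE)
    hence "(of_nat CARD('a) :: 'a) = 1" using 2 by simp
    thus False using of_nat_card_eq_0[where ?'a='a] by simp
  qed
  obtain \<psi> :: "'a \<Rightarrow> complex" where "nontrivial_add_char \<psi>" using ex_nontrivial_add_char by blast
  then interpret nontrivial_add_char \<psi> .
  define f where "f = (indicator E :: 'a ^ 'd \<Rightarrow> real)"
  have sum_ind: "(\<Sum>x\<in>UNIV. indicator E x :: real) = real (card E)"
    by (simp add: indicator_def sum.If_cases)
  define h where "h = (\<lambda>x :: 'a ^ 'd. sphere_ind t x - 1 / q)"
  have conv_h: "conv f h x = conv f (sphere_ind t) x - real (card E) / q" for x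
    by (simp add: conv_def h_def f_def right_diff_distrib sum_subtractf sum_divide_distrib[symmetric]
        sum_ind)
  define B where "B = 2 * sqrt q ^ (CARD('d) + 1) / q"
  have "q ^ CARD('d) * (\<Sum>x\<in>UNIV. (conv f h x)\<^sup>2) = (\<Sum>\<xi>\<in>UNIV. (cmod (fourier (\<lambda>x. of_real (conv f h x)) \<xi>))\<^sup>2)"
    by (simp add: parseval q_def)
  also have "\<dots> \<le> (\<Sum>\<xi>\<in>UNIV. B\<^sup>2 * (cmod (fourier (\<lambda>x. of_real (f x)) \<xi>))\<^sup>2)"
  proof (rule sum_mono)
    fix \<xi> :: "'a ^ 'd"
    have "cmod (fourier (\<lambda>x. of_real (h x)) \<xi>) \<le> B"
      unfolding h_def B_def q_def by (rule fourier_sphere_bound[OF two assms(2)])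
    hence "(cmod (fourier (\<lambda>x. of_real (h x)) \<xi>))\<^sup>2 \<le> B\<^sup>2"
      by (intro power_mono) auto
    hence "(cmod (fourier (\<lambda>x. of_real (h x)) \<xi>))\<^sup>2 * (cmod (fourier (\<lambda>x. of_real (f x)) \<xi>))\<^sup>2
        \<le> B\<^sup>2 * (cmod (fourier (\<lambda>x. of_real (f x)) \<xi>))\<^sup>2"
      by (intro mult_right_mono) auto
    thus "(cmod (fourier (\<lambda>x. of_real (conv f h x)) \<xi>))\<^sup>2 \<le> B\<^sup>2 * (cmod (fourier (\<lambda>x. of_real (f x)) \<xi>))\<^sup>2"
      by (simp add: fourier_conv norm_mult power_mult_distrib mult.commute)
  qed
  also have "\<dots> = B\<^sup>2 * (q ^ CARD('d) * (\<Sum>x\<in>UNIV. (cmod (of_real (f x)))\<^sup>2))"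
    by (simp only: sum_distrib_left[symmetric] parseval q_def)
  also have "(\<Sum>x\<in>UNIV. (cmod (of_real (f x)))\<^sup>2) = real (card E)"
  proof -
    have "(cmod (of_real (f x)))\<^sup>2 = indicator E x" for x by (simp add: f_def indicator_def)
    thus ?thesis by (simp add: sum_ind)
  qed
  finally have "q ^ CARD('d) * (\<Sum>x\<in>UNIV. (conv f h x)\<^sup>2) \<le> q ^ CARD('d) * (B\<^sup>2 * real (card E))"
    by (simp only: mult_ac)
  hence "(\<Sum>x\<in>UNIV. (conv f h x)\<^sup>2) \<le> B\<^sup>2 * real (card E)"
    using q by simp
  also have "B\<^sup>2 = 4 * q ^ (CARD('d) - 1)"
  proof -
    have "(sqrt q ^ (CARD('d) + 1))\<^sup>2 = ((sqrt q)\<^sup>2) ^ (CARD('d) + 1)"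
      by (simp only: power_mult[symmetric] mult.commute)
    also have "\<dots> = q ^ (CARD('d) + 1)" using q by simp
    also have "\<dots> = q ^ ((CARD('d) - 1) + 2)"
      using zero_less_card_finite[where ?'a='d] by (intro arg_cong[of _ _ "\<lambda>n. q ^ n"]) linarith
    finally have "(sqrt q ^ (CARD('d) + 1))\<^sup>2 = q ^ (CARD('d) - 1) * q\<^sup>2"
      unfolding power_add[of q] .
    thus ?thesis using q by (simp add: B_def power_divide power_mult_distrib)
  qed
  finally show ?thesis
    unfolding conv_h unfolding f_def q_def .
qed

theorem mainTheorem4:
  fixes t :: "'a::{field,finite}"
    and E :: "('a ^ ('d::finite)) set"
    and q d :: nat
    and C lam :: real
  assumes "q = CARD('a)" and "odd q"
    and "d = CARD('d)" and "d \<ge> 2"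
    and "t \<noteq> 0"
    and "C > 4"
    and "real (card E) \<ge> C * real q powr ((real d + 1) / 2)"
    and "lam > 2 * C / (C - 4)"
  shows "\<exists>E'\<subseteq>E.
           real (card E') \<ge> (1 - 2 * inverse lam) / (2 * lam) * real (card E) \<and>
           (\<forall>x\<in>E'. inverse lam * (real (card E) / real q) \<le> conv (indicator E) (sphere_ind t) x \<and>
                   conv (indicator E) (sphere_ind t) x \<le> lam * (real (card E) / real q))"
proof -
  define N where "N = real (card E)"
  define A where "A = N / real q"
  define u where "u = inverse lam"
  define f where "f = conv (indicator E) (sphere_ind t)"
  have q: "real q > 0" using assms(1) by simp
  have "2 * C / (C - 4) > 2" using assms(6) by (simp add: field_simps)
  hence lam: "lam > 2" using assms(8) by linarith
  have u: "0 < u" "u < 1 / 2" "u * lam = 1" using lam by (simp_all add: u_def field_simps)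
  \<comment> \<open>The hypothesis on \<open>lam\<close>, rewritten as
    \<open>u < (C - 4) / (2 * C)\<close>.\<close>
  have u_C: "1 - u \<ge> (C + 4) / (2 * C)"
  proof -
    have "2 * C < lam * (C - 4)" using assms(6,8) by (simp add: pos_divide_less_eq)
    hence "u * (2 * C) < u * (lam * (C - 4))" using u(1) by (intro mult_strict_left_mono)
    also have "\<dots> = C - 4" using u(3) by (simp flip: mult.assoc)
    finally show ?thesis using assms(6) by (simp add: field_simps)
  qed
  have N2: "N\<^sup>2 \<ge> C\<^sup>2 * real q ^ (d + 1)"
  proof -
    have "(real q powr ((real d + 1) / 2))\<^sup>2 = real q powr (real (d + 1))"
      using q by (simp add: power2_eq_square add.commute flip: powr_add)
    also have "\<dots> = real q ^ (d + 1)" using q by (rule powr_realpow)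
    finally have "(C * real q powr ((real d + 1) / 2))\<^sup>2 = C\<^sup>2 * real q ^ (d + 1)"
      by (simp only: power_mult_distrib)
    moreover have "(C * real q powr ((real d + 1) / 2))\<^sup>2 \<le> N\<^sup>2"
      using assms(6,7) by (intro power_mono) (auto simp: N_def)
    ultimately show ?thesis by simp
  qed
  have "C * real q powr ((real d + 1) / 2) > 0" using q assms(6) by simp
  hence N: "N > 0" using assms(7) by (simp add: N_def)
  hence A: "A > 0" using q by (simp add: A_def)

  \<comment> \<open>Such points satisfy \<open>u * A \<le> f x \<le> (2 - u) * A\<close>, and
    \<open>2 - u\<close> is below \<open>lam\<close> because \<open>lam > 2\<close>.\<close>
  define G where "G = {x \<in> E. \<bar>f x - A\<bar> \<le> (1 - u) * A}"
  have "real (card (E - G)) * ((1 - u) * A)\<^sup>2 = (\<Sum>x\<in>E - G. ((1 - u) * A)\<^sup>2)"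
    by simp
  also have "\<dots> \<le> (\<Sum>x\<in>E - G. (f x - A)\<^sup>2)"
  proof (rule sum_mono)
    fix x assume "x \<in> E - G"
    hence "(1 - u) * A \<le> \<bar>f x - A\<bar>" by (auto simp: G_def)
    hence "((1 - u) * A)\<^sup>2 \<le> \<bar>f x - A\<bar>\<^sup>2"
      using u A by (intro power_mono) auto
    thus "((1 - u) * A)\<^sup>2 \<le> (f x - A)\<^sup>2" by simp
  qed
  also have "\<dots> \<le> (\<Sum>x\<in>UNIV. (f x - A)\<^sup>2)"
    by (intro sum_mono2) auto
  also have "\<dots> \<le> 4 * real q ^ (d - 1) * N"
    using conv_sphere_variance_le[of t E] assms(1,2,3,5) by (simp add: f_def A_def N_def)
  finally have cheb: "real (card (E - G)) * ((1 - u) * A)\<^sup>2 \<le> 4 * real q ^ (d - 1) * N" .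
  have A2: "C\<^sup>2 * real q ^ (d - 1) \<le> A\<^sup>2"
  proof -
    have "d + 1 = (d - 1) + 2" using assms(4) by simp
    hence "C\<^sup>2 * real q ^ (d + 1) = (C\<^sup>2 * real q ^ (d - 1)) * (real q)\<^sup>2"
      by (simp only: power_add mult.assoc)
    hence "(C\<^sup>2 * real q ^ (d - 1)) * (real q)\<^sup>2 \<le> N\<^sup>2" using N2 by (simp only:)
    thus ?thesis using q by (simp add: A_def power_divide pos_le_divide_eq)
  qed
  have "(C + 4)\<^sup>2 / (4 * C\<^sup>2) \<le> (1 - u)\<^sup>2"
  proof -
    have "((C + 4) / (2 * C))\<^sup>2 \<le> (1 - u)\<^sup>2" using u_C assms(6) by (intro power_mono) auto
    thus ?thesis by (simp add: power_divide power_mult_distrib)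
  qed
  hence "((C + 4)\<^sup>2 / (4 * C\<^sup>2)) * (C\<^sup>2 * real q ^ (d - 1)) \<le> (1 - u)\<^sup>2 * A\<^sup>2"
    using A2 by (intro mult_mono) auto
  hence "((C + 4)\<^sup>2 / 4) * real q ^ (d - 1) \<le> ((1 - u) * A)\<^sup>2"
    using assms(6) by (simp add: power_mult_distrib)
  \<comment> \<open>\<open>C > 4\<close> enters here: 16 is four times the constant 4 of the
    variance bound, so at most a quarter of \<open>E\<close> can be bad.\<close>
  moreover have "16 * real q ^ (d - 1) \<le> ((C + 4)\<^sup>2 / 4) * real q ^ (d - 1)"
  proof (rule mult_right_mono)
    have "8\<^sup>2 \<le> (C + 4)\<^sup>2" using assms(6) by (intro power_mono) auto
    thus "16 \<le> (C + 4)\<^sup>2 / 4" by simp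
  qed (use q in simp)
  ultimately have "16 * real q ^ (d - 1) \<le> ((1 - u) * A)\<^sup>2" by linarith
  hence "real (card (E - G)) * (16 * real q ^ (d - 1)) \<le> real (card (E - G)) * ((1 - u) * A)\<^sup>2"
    by (intro mult_left_mono) auto
  hence "real q ^ (d - 1) * (4 * real (card (E - G))) \<le> real q ^ (d - 1) * N"
    using cheb by (simp add: algebra_simps)
  hence bad: "4 * real (card (E - G)) \<le> N"
    using q by simp
  have "G \<subseteq> E" by (auto simp: G_def)
  hence "card (E - G) = card E - card G" "card G \<le> card E"
    by (auto intro: card_Diff_subset card_mono)
  hence "real (card G) = N - real (card (E - G))"
    by (simp add: N_def of_nat_diff)
  hence good: "real (card G) \<ge> 3 / 4 * N" using bad by linarith
  \<comment> \<open>The required share of \<open>E\<close> never exceeds one half, while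
    \<open>G\<close> has three quarters.\<close>
  have "(1 - 2 * inverse lam) / (2 * lam) = (1 - 2 * u) * u / 2"
    by (simp add: u_def field_simps)
  also have "\<dots> \<le> 1 * 1 / 2"
    using u by (intro divide_right_mono mult_mono) auto
  also have "\<dots> \<le> 3 / (4 :: real)" by simp
  finally have "(1 - 2 * inverse lam) / (2 * lam) * N \<le> 3 / 4 * N"
    using N by (rule mult_right_mono[OF _ less_imp_le])
  hence "real (card G) \<ge> (1 - 2 * inverse lam) / (2 * lam) * N"
    using good by linarith
  moreover have "u * A \<le> f x \<and> f x \<le> lam * A" if "x \<in> G" for x
  proof -
    have x: "\<bar>f x - A\<bar> \<le> (1 - u) * A" using that by (simp add: G_def)
    have "f x - A \<ge> - ((1 - u) * A)" "f x - A \<le> (1 - u) * A" using x by linarith+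
    moreover have "2 * A \<le> lam * A" using lam A by (intro mult_right_mono) auto
    moreover have "u * A \<ge> 0" using u A by simp
    ultimately show ?thesis by (simp add: algebra_simps)
  qed
  ultimately show ?thesis
    using \<open>G \<subseteq> E\<close> by (intro exI[of _ G]) (auto simp: N_def A_def u_def f_def)
qed

end
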